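(* Let $G$ be an infinite countable discrete amenable group with a F\o lner sequence $\mathbf{F}$, and let $(X,G)$ be a $G$-system. If $(X,G)$ is mildly mixing, then the following properties hold: (1) for each admissible open cover $\mathcal{U}$ of $X$ and each infinite $IP$-set $H$ of $G$, there exists an infinite subset $S\subset H$ such that $h_{\mathrm{top}}^{S,\mathbf{F}}(G,\mathcal{U})=\log\mathcal{N}(\mathcal{U})$; (2) for each non-trivial finite open cover $\mathcal{U}$ of $X$ and each infinite $IP$-set $H$ of $G$, there exists an infinite subset $S\subset H$ such that $h_{\mathrm{top}}^{S,\mathbf{F}}(G,\mathcal{U})>0$.
   Context: The F\o lner sequence $\mathbf{F}=\{F_n\}_{n=1}^\infty$ is a sequence of finite subsets of $G$ with $\lim_{n\to\infty}|gF_n\triangle F_n|/|F_n|=0$ for every $g\in G$, $e_G\in F_1\subseteq F_2\subseteq\cdots$ and $\bigcup_n F_n=G$. A $G$-system $(X,G)$ is a compact metric space $X$ with a continuous action of $G$; products carry the diagonal action. A point $x\in X$ is transitive if its orbit $\{gx:g\in G\}$ is dense in $X$, and recurrent if $\{g\in G:gx\in U\}$ is infinite for every neighborhood $U$ of $x$. A $G$-system is transitive recurrent if it has a point that is both transitive and recurrent. A $G$-system $(X,G)$ is mildly mixing if $(X\times Y,G)$ is transitive recurrent for every transitive recurrent $G$-system $(Y,G)$. For a sequence $\{p_i\}_{i=1}^\infty$ in $G$, $FP(\{p_i\}_{i=1}^\infty)$ is the set of all products $p_{n_1}p_{n_2}\cdots p_{n_k}$ with $k\ge 1$ and $n_1<n_2<\cdots<n_k$.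 A subset of $G$ is an infinite $IP$-set if it contains $FP(\{p_i\}_{i=1}^\infty)$ for some sequence $\{p_i\}_{i=1}^\infty$ in $G$ for which $FP(\{p_i\}_{i=1}^\infty)$ is infinite. An open cover $\mathcal{U}=\{U_1,\ldots,U_n\}$ of $X$ is non-trivial if no $U_i$ is dense in $X$. An open cover $\{U_i\}_{i\in I}$ is admissible if $U_i\setminus\bigcup_{j\in I,j\neq i}U_j$ has nonempty interior for each $i\in I$ (such a cover of a compact space is necessarily finite). For a finite open cover $\mathcal{U}$, $\mathcal{N}(\mathcal{U})$ is the minimal cardinality of a subcover, $g^{-1}\mathcal{U}=\{g^{-1}U:U\in\mathcal{U}\}$, and $\bigvee$ denotes the common refinement. For an infinite subset $S\subset G$, $$h_{\mathrm{top}}^{S,\mathbf{F}}(G,\mathcal{U})=\limsup_{n\to\infty}\frac{1}{|S\cap F_n|}\log\mathcal{N}\Big(\bigvee_{g\in S\cap F_n}g^{-1}\mathcal{U}\Big).$$ *)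

theory Defs
  imports "HOL-Analysis.Analysis" "HOL-Algebra.Coset" "HOL-Algebra.Group_Action"
begin

no_notation eq_closure_of (\<open>closure'_of\<index>\<close>)

section \<open>Amenability and Folner sequences\<close>

definition asymptotically_invariant ::
  "('g, 'm) monoid_scheme \<Rightarrow> (nat \<Rightarrow> 'g set) \<Rightarrow> bool" where
  "asymptotically_invariant G F \<longleftrightarrow>
     (\<forall>n. F n \<subseteq> carrier G \<and> finite (F n) \<and> F n \<noteq> {}) \<and>
     (\<forall>g\<in>carrier G.
        (\<lambda>n. real (card (sym_diff (g <#\<^bsub>G\<^esub> F n) (F n))) / real (card (F n))) \<longlonglongrightarrow> 0)"

text \<open>The Folner characterisation, appropriate for countable discrete groups only.\<close>

definition amenable :: "('g, 'm) monoid_scheme \<Rightarrow> bool" where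
  "amenable G \<longleftrightarrow> (\<exists>F. asymptotically_invariant G F)"

text \<open>All sequences are indexed from \<open>0\<close>: \<open>F n\<close> stands for the set usually written with
  index \<open>n + 1\<close>.\<close>

definition folner_sequence :: "('g, 'm) monoid_scheme \<Rightarrow> (nat \<Rightarrow> 'g set) \<Rightarrow> bool" where
  "folner_sequence G F \<longleftrightarrow>
     asymptotically_invariant G F \<and> \<one>\<^bsub>G\<^esub> \<in> F 0 \<and> incseq F \<and> (\<Union>n. F n) = carrier G"


section \<open>Dynamical systems\<close>

text \<open>The group is discrete, so continuity of the action amounts to continuity of each \<open>\<phi> g\<close>.
  No notion below depends on the choice of a metric, hence compact metric spaces are given as
  compact metrizable topologies.\<close>

definition G_system ::
  "('g, 'm) monoid_scheme \<Rightarrow> 'x topology \<Rightarrow> ('g \<Rightarrow> 'x \<Rightarrow> 'x) \<Rightarrow> bool" where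
  "G_system G X \<phi> \<longleftrightarrow>
     compact_space X \<and> metrizable_space X \<and> group_action G (topspace X) \<phi> \<and>
     (\<forall>g\<in>carrier G. continuous_map X X (\<phi> g))"

text \<open>\<open>group_action\<close> requires maps that are extensional on their carrier, whence the
  \<open>restrict\<close>.\<close>

definition diagonal_action ::
  "'x topology \<Rightarrow> ('g \<Rightarrow> 'x \<Rightarrow> 'x) \<Rightarrow> 'y topology \<Rightarrow> ('g \<Rightarrow> 'y \<Rightarrow> 'y) \<Rightarrow> 'g \<Rightarrow> 'x \<times> 'y \<Rightarrow> 'x \<times> 'y" where
  "diagonal_action X \<phi> Y \<psi> g =
     restrict (\<lambda>(x, y). (\<phi> g x, \<psi> g y)) (topspace X \<times> topspace Y)"

definition transitive_point ::
  "('g, 'm) monoid_scheme \<Rightarrow> 'x topology \<Rightarrow> ('g \<Rightarrow> 'x \<Rightarrow> 'x) \<Rightarrow> 'x \<Rightarrow> bool" where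
  "transitive_point G X \<phi> x \<longleftrightarrow>
     x \<in> topspace X \<and> X closure_of (orbit G \<phi> x) = topspace X"

definition recurrent_point ::
  "('g, 'm) monoid_scheme \<Rightarrow> 'x topology \<Rightarrow> ('g \<Rightarrow> 'x \<Rightarrow> 'x) \<Rightarrow> 'x \<Rightarrow> bool" where
  "recurrent_point G X \<phi> x \<longleftrightarrow>
     x \<in> topspace X \<and>
     (\<forall>U. openin X U \<longrightarrow> x \<in> U \<longrightarrow> infinite {g \<in> carrier G. \<phi> g x \<in> U})"

definition transitive_recurrent ::
  "('g, 'm) monoid_scheme \<Rightarrow> 'x topology \<Rightarrow> ('g \<Rightarrow> 'x \<Rightarrow> 'x) \<Rightarrow> bool" where
  "transitive_recurrent G X \<phi> \<longleftrightarrow>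
     (\<exists>x. transitive_point G X \<phi> x \<and> recurrent_point G X \<phi> x)"

text \<open>A definition cannot quantify over types, so \<open>Y\<close> ranges over all compact metrizable
  topologies on sets of reals (with no relation to the usual topology of the reals).  Since a
  compact metrizable space has at most the cardinality of the continuum, this covers every
  \<open>G\<close>-system up to isomorphism: see \<open>mildly_mixing_any_type\<close> below.\<close>

definition mildly_mixing ::
  "('g, 'm) monoid_scheme \<Rightarrow> 'x topology \<Rightarrow> ('g \<Rightarrow> 'x \<Rightarrow> 'x) \<Rightarrow> bool" where
  "mildly_mixing G X \<phi> \<longleftrightarrow>
     (\<forall>(Y :: real topology) \<psi>. G_system G Y \<psi> \<longrightarrow> transitive_recurrent G Y \<psi> \<longrightarrow>
        transitive_recurrent G (prod_topology X Y) (diagonal_action X \<phi> Y \<psi>))"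

lemma G_system_in_topspace:
  assumes "G_system G X \<phi>" "g \<in> carrier G" "x \<in> topspace X"
  shows "\<phi> g x \<in> topspace X"
  using assms unfolding G_system_def continuous_map_def by blast

lemma transitive_recurrent_factor:
  assumes sys: "\<And>g x. g \<in> carrier G \<Longrightarrow> x \<in> topspace X \<Longrightarrow> \<phi> g x \<in> topspace X"
    and f: "continuous_map X Y f" "f ` topspace X = topspace Y"
    and eq: "\<And>g x. g \<in> carrier G \<Longrightarrow> x \<in> topspace X \<Longrightarrow> f (\<phi> g x) = \<psi> g (f x)"
    and tr: "transitive_recurrent G X \<phi>"
  shows "transitive_recurrent G Y \<psi>"
proof -
  obtain x where x: "x \<in> topspace X" and t: "X closure_of (orbit G \<phi> x) = topspace X"
    and r: "\<And>U. openin X U \<Longrightarrow> x \<in> U \<Longrightarrow> infinite {g \<in> carrier G. \<phi> g x \<in> U}"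
    using tr unfolding transitive_recurrent_def transitive_point_def recurrent_point_def by blast
  have fx: "f x \<in> topspace Y"
    using x f(2) by blast
  have orb: "f ` orbit G \<phi> x = orbit G \<psi> (f x)"
    unfolding orbit_def using eq x by (force simp: image_iff)
  have "topspace Y = f ` (X closure_of orbit G \<phi> x)"
    using t f(2) by simp
  also have "\<dots> \<subseteq> Y closure_of (orbit G \<psi> (f x))"
    using continuous_map_image_closure_subset[OF f(1)] orb by metis
  finally have 1: "Y closure_of (orbit G \<psi> (f x)) = topspace Y"
    using closure_of_subset_topspace by (metis subset_antisym)
  have 2: "infinite {g \<in> carrier G. \<psi> g (f x) \<in> U}" if "openin Y U" "f x \<in> U" for U
  proof -
    have "openin X {z \<in> topspace X. f z \<in> U}"
      using f(1) that(1) by (simp add: continuous_map_def)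
    then have "infinite {g \<in> carrier G. \<phi> g x \<in> {z \<in> topspace X. f z \<in> U}}"
      using r x that(2) by blast
    moreover have "{g \<in> carrier G. \<phi> g x \<in> {z \<in> topspace X. f z \<in> U}}
        \<subseteq> {g \<in> carrier G. \<psi> g (f x) \<in> U}"
      using eq x by auto
    ultimately show ?thesis
      using finite_subset by blast
  qed
  show ?thesis
    unfolding transitive_recurrent_def transitive_point_def recurrent_point_def
    using fx 1 2 by blast
qed

lemma compact_metrizable_lepoll_real:
  assumes "compact_space X" "metrizable_space X"
  shows "topspace X \<lesssim> (UNIV :: real set)"
proof -
  obtain M d where M: "Metric_space M d" and X: "X = Metric_space.mtopology M d"
    using assms(2) unfolding metrizable_space_def by blast
  interpret Metric_space M d by (fact M)
  have "mtotally_bounded M"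
    using assms(1) X compactin_imp_mtotally_bounded by (simp add: compact_space_def)
  then have "\<forall>n. \<exists>K. finite K \<and> K \<subseteq> M \<and> M \<subseteq> (\<Union>x\<in>K. mball x (1 / real (Suc n)))"
    unfolding mtotally_bounded_def by simp
  then obtain K where K: "\<And>n. finite (K n)" "\<And>n. K n \<subseteq> M"
      "\<And>n. M \<subseteq> (\<Union>x\<in>K n. mball x (1 / real (Suc n)))"
    by metis
  define D where "D = (\<Union>n. K n) \<times> (UNIV :: nat set)"
  have "countable D"
    unfolding D_def using K(1) by (auto intro: countable_finite)
  then obtain e :: "'a \<times> nat \<Rightarrow> nat" where e: "inj_on e D"
    unfolding countable_def by blast
  define c where "c x = e ` {(k, n). (k, n) \<in> D \<and> d k x < 1 / real (Suc n)}" for x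
  have "inj_on c M"
  proof (rule inj_onI, rule ccontr)
    fix x y assume xy: "x \<in> M" "y \<in> M" "c x = c y" "x \<noteq> y"
    then have "d x y > 0" by simp
    then obtain n where n: "1 / real (Suc n) < d x y / 2"
      using nat_approx_posE[of "d x y / 2"] by auto
    obtain k where k: "k \<in> K n" "k \<in> M" "d k x < 1 / real (Suc n)"
      using K(3)[of n] xy(1) by auto
    have "{(k, n). (k, n) \<in> D \<and> d k x < 1 / real (Suc n)}
        = {(k, n). (k, n) \<in> D \<and> d k y < 1 / real (Suc n)}"
      using xy(3) unfolding c_def by (subst (asm) inj_on_image_eq_iff[OF e]) auto
    moreover have "(k, n) \<in> D"
      using k(1) unfolding D_def by blast
    ultimately have "d k y < 1 / real (Suc n)"
      using k(3) by blast
    moreover have "d x y \<le> d k x + d k y"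
      using triangle[of x k y] commute[of x k] xy k(2) by simp
    ultimately show False
      using n k(3) by linarith
  qed
  then have "M \<lesssim> (UNIV :: nat set set)"
    unfolding lepoll_def by blast
  also have "(UNIV :: nat set set) \<lesssim> (UNIV :: real set)"
    by (rule eqpoll_imp_lepoll[OF nat_sets_eqpoll_reals])
  finally show ?thesis
    using X by simp
qed

lemma G_system_real_copy:
  fixes Y :: "'y topology"
  assumes sys: "G_system G Y \<psi>"
  obtains Z :: "real topology" and \<zeta> f h where
    "G_system G Z \<zeta>" "homeomorphic_maps Y Z f h"
    "\<And>g y. g \<in> carrier G \<Longrightarrow> y \<in> topspace Y \<Longrightarrow> f (\<psi> g y) = \<zeta> g (f y)"
    "\<And>g z. g \<in> carrier G \<Longrightarrow> z \<in> topspace Z \<Longrightarrow> h (\<zeta> g z) = \<psi> g (h z)"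
proof -
  define T where "T = topspace Y"
  have cpt: "compact_space Y" and met: "metrizable_space Y"
    and act: "group_action G T \<psi>" and cont: "\<And>g. g \<in> carrier G \<Longrightarrow> continuous_map Y Y (\<psi> g)"
    using sys unfolding G_system_def T_def by auto
  obtain f :: "'y \<Rightarrow> real" where inj: "inj_on f T"
    using compact_metrizable_lepoll_real[OF cpt met] unfolding lepoll_def T_def by blast
  define h where "h = inv_into T f"
  define Z where "Z = pullback_topology (f ` T) h Y"
  define \<zeta> where "\<zeta> g = restrict (\<lambda>z. f (\<psi> g (h z))) (f ` T)" for g
  have hf: "h (f y) = y" if "y \<in> T" for y
    using that inj by (simp add: h_def)
  have fh: "f (h z) = z" "h z \<in> T" if "z \<in> f ` T" for z
    using that by (auto simp: h_def f_inv_into_f inv_into_into)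
  have topZ: "topspace Z = f ` T"
    using fh(2) unfolding Z_def topspace_pullback_topology T_def by auto
  have ch: "continuous_map Z Y h"
    using continuous_map_pullback[of Y Y id "f ` T" h] by (simp add: Z_def)
  have cf: "continuous_map Y Z f"
    unfolding Z_def
  proof (rule continuous_map_pullback')
    show "continuous_map Y Y (h \<circ> f)"
      by (rule continuous_map_eq[of _ _ id]) (auto simp: hf T_def[symmetric])
  qed (auto simp: T_def)
  have hom: "homeomorphic_maps Y Z f h"
    unfolding homeomorphic_maps_def using cf ch hf fh topZ T_def by auto
  have psiT: "\<psi> g y \<in> T" if "g \<in> carrier G" "y \<in> T" for g y
    using G_system_in_topspace[OF sys] that by (simp add: T_def)
  have eqf: "f (\<psi> g y) = \<zeta> g (f y)" if "g \<in> carrier G" "y \<in> T" for g y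
    using that hf by (simp add: \<zeta>_def)
  have eqh: "h (\<zeta> g z) = \<psi> g (h z)" if "g \<in> carrier G" "z \<in> f ` T" for g z
    using that fh hf psiT by (simp add: \<zeta>_def)
  interpret A: group_action G T \<psi> by (fact act)
  have grp: "group G"
    using act unfolding group_action_def group_hom_def by blast
  have Bij: "\<zeta> g \<in> Bij (f ` T)" if g: "g \<in> carrier G" for g
  proof -
    have b: "bij_betw (\<psi> g) T T"
      using A.bij_prop0[OF g] by (simp add: Bij_def bij_betw_def)
    have bf: "bij_betw f T (f ` T)"
      using inj by (rule inj_on_imp_bij_betw)
    have bh: "bij_betw h (f ` T) T"
      unfolding h_def by (rule bij_betw_inv_into[OF bf])
    have "bij_betw (f \<circ> (\<psi> g \<circ> h)) (f ` T) (f ` T)"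
      by (rule bij_betw_trans[OF bij_betw_trans[OF bh b] bf])
    moreover have "(f \<circ> (\<psi> g \<circ> h)) z = \<zeta> g z" if "z \<in> f ` T" for z
      using that by (simp add: \<zeta>_def)
    ultimately have "bij_betw (\<zeta> g) (f ` T) (f ` T)"
      using bij_betw_cong by metis
    then show ?thesis
      by (simp add: Bij_def \<zeta>_def)
  qed
  have "\<zeta> (a \<otimes>\<^bsub>G\<^esub> b) = compose (f ` T) (\<zeta> a) (\<zeta> b)"
    if "a \<in> carrier G" "b \<in> carrier G" for a b
  proof
    fix z
    show "\<zeta> (a \<otimes>\<^bsub>G\<^esub> b) z = compose (f ` T) (\<zeta> a) (\<zeta> b) z"
    proof (cases "z \<in> f ` T")
      case True
      then have "\<psi> (a \<otimes>\<^bsub>G\<^esub> b) (h z) = \<psi> a (\<psi> b (h z))"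
        using A.composition_rule[of "h z" a b] fh(2) that by blast
      then show ?thesis
        using True that hf psiT fh by (simp add: \<zeta>_def compose_def)
    qed (simp add: \<zeta>_def compose_def)
  qed
  then have "group_hom G (BijGroup (f ` T)) \<zeta>"
    unfolding group_hom_def group_hom_axioms_def
    using grp group_BijGroup Bij by (auto simp: hom_def BijGroup_def)
  then have "group_action G (f ` T) \<zeta>"
    by (simp add: group_action_def)
  moreover have "continuous_map Z Z (\<zeta> g)" if "g \<in> carrier G" for g
  proof -
    have "continuous_map Z Z (f \<circ> (\<psi> g \<circ> h))"
      by (rule continuous_map_compose[OF continuous_map_compose[OF ch cont[OF that]] cf])
    then show ?thesis
      by (rule continuous_map_eq) (simp add: \<zeta>_def topZ)
  qed
  moreover have YZ: "Y homeomorphic_space Z"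
    using hom unfolding homeomorphic_space_def by blast
  moreover have "compact_space Z"
    using homeomorphic_compact_space[OF YZ] cpt by simp
  moreover have "metrizable_space Z"
    using homeomorphic_metrizable_space[OF YZ] met by simp
  ultimately have "G_system G Z \<zeta>"
    unfolding G_system_def topZ by blast
  then show thesis
    by (rule that[OF _ hom]) (use eqf eqh topZ in \<open>auto simp: T_def\<close>)
qed

lemma mildly_mixing_any_type:
  fixes X :: "'x topology" and Y :: "'y topology"
  assumes X: "G_system G X \<phi>" and mm: "mildly_mixing G X \<phi>"
    and Y: "G_system G Y \<psi>" "transitive_recurrent G Y \<psi>"
  shows "transitive_recurrent G (prod_topology X Y) (diagonal_action X \<phi> Y \<psi>)"
proof -
  obtain Z :: "real topology" and \<zeta> f h where Z: "G_system G Z \<zeta>"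
    and hom: "homeomorphic_maps Y Z f h"
    and f: "\<And>g y. g \<in> carrier G \<Longrightarrow> y \<in> topspace Y \<Longrightarrow> f (\<psi> g y) = \<zeta> g (f y)"
    and h: "\<And>g z. g \<in> carrier G \<Longrightarrow> z \<in> topspace Z \<Longrightarrow> h (\<zeta> g z) = \<psi> g (h z)"
    using G_system_real_copy[OF Y(1)] by blast
  have cf: "continuous_map Y Z f" and ch: "continuous_map Z Y h"
    and hf: "\<And>y. y \<in> topspace Y \<Longrightarrow> h (f y) = y" and fh: "\<And>z. z \<in> topspace Z \<Longrightarrow> f (h z) = z"
    using hom by (simp_all add: homeomorphic_maps_def)
  have fT: "f y \<in> topspace Z" if "y \<in> topspace Y" for y
    using cf that by (auto simp: continuous_map_def)
  have hT: "h z \<in> topspace Y" if "z \<in> topspace Z" for z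
    using ch that by (auto simp: continuous_map_def)
  have imf: "f ` topspace Y = topspace Z"
    using fT hT fh by (force simp: image_iff)
  have imh: "h ` topspace Z = topspace Y"
    using fT hT hf by (force simp: image_iff)
  have "transitive_recurrent G Z \<zeta>"
    by (rule transitive_recurrent_factor[where X = Y and \<phi> = \<psi> and f = f])
       (use G_system_in_topspace[OF Y(1)] cf imf f Y(2) in auto)
  then have XZ: "transitive_recurrent G (prod_topology X Z) (diagonal_action X \<phi> Z \<zeta>)"
    using mm Z unfolding mildly_mixing_def by blast
  show ?thesis
  proof (rule transitive_recurrent_factor[where f = "\<lambda>(x, z). (x, h z)", OF _ _ _ _ XZ])
    show "continuous_map (prod_topology X Z) (prod_topology X Y) (\<lambda>(x, z). (x, h z))"
      using continuous_map_prod_top[of X Z X Y id h] ch by simp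
    show "(\<lambda>(x, z). (x, h z)) ` topspace (prod_topology X Z) = topspace (prod_topology X Y)"
      using imh by (force simp: image_iff)
  qed (use G_system_in_topspace[OF X] G_system_in_topspace[OF Z] hT h
      in \<open>auto simp: diagonal_action_def\<close>)
qed


section \<open>Infinite IP-sets\<close>

definition finite_products :: "('g, 'm) monoid_scheme \<Rightarrow> (nat \<Rightarrow> 'g) \<Rightarrow> 'g set" where
  "finite_products G p =
     {foldr (\<lambda>i a. p i \<otimes>\<^bsub>G\<^esub> a) ns \<one>\<^bsub>G\<^esub> | ns. ns \<noteq> [] \<and> sorted_wrt (<) ns}"

definition infinite_IP_set :: "('g, 'm) monoid_scheme \<Rightarrow> 'g set \<Rightarrow> bool" where
  "infinite_IP_set G H \<longleftrightarrow>
     H \<subseteq> carrier G \<and>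
     (\<exists>p. range p \<subseteq> carrier G \<and> infinite (finite_products G p) \<and> finite_products G p \<subseteq> H)"


section \<open>Open covers and sequence entropy\<close>

definition open_cover :: "'x topology \<Rightarrow> 'x set set \<Rightarrow> bool" where
  "open_cover X \<U> \<longleftrightarrow> (\<forall>U\<in>\<U>. openin X U) \<and> \<Union>\<U> = topspace X"

definition nontrivial_cover :: "'x topology \<Rightarrow> 'x set set \<Rightarrow> bool" where
  "nontrivial_cover X \<U> \<longleftrightarrow> open_cover X \<U> \<and> (\<forall>U\<in>\<U>. X closure_of U \<noteq> topspace X)"

text \<open>Covers are sets rather than indexed families; an admissible family has no repetitions
  anyway, since a repeated member would leave an empty difference.\<close>

definition admissible_cover :: "'x topology \<Rightarrow> 'x set set \<Rightarrow> bool" where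
  "admissible_cover X \<U> \<longleftrightarrow>
     open_cover X \<U> \<and> (\<forall>U\<in>\<U>. X interior_of (U - \<Union>(\<U> - {U})) \<noteq> {})"

definition cover_number :: "'x topology \<Rightarrow> 'x set set \<Rightarrow> nat" where
  "cover_number X \<U> = Inf {card \<V> | \<V>. \<V> \<subseteq> \<U> \<and> finite \<V> \<and> \<Union>\<V> = topspace X}"

text \<open>Intersecting with \<open>topspace X\<close> only matters when \<open>A\<close> is empty; the refinement is then
  the one-element cover.\<close>

definition common_refinement :: "'x topology \<Rightarrow> 'i set \<Rightarrow> ('i \<Rightarrow> 'x set set) \<Rightarrow> 'x set set" where
  "common_refinement X A \<U> = {topspace X \<inter> (\<Inter>i\<in>A. V i) | V. \<forall>i\<in>A. V i \<in> \<U> i}"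

definition inverse_translate ::
  "('g, 'm) monoid_scheme \<Rightarrow> ('g \<Rightarrow> 'x \<Rightarrow> 'x) \<Rightarrow> 'g \<Rightarrow> 'x set set \<Rightarrow> 'x set set" where
  "inverse_translate G \<phi> g \<U> = (\<lambda>U. \<phi> (inv\<^bsub>G\<^esub> g) ` U) ` \<U>"

text \<open>For the finitely many \<open>n\<close> for which \<open>S \<inter> F n\<close> may be empty the quotient is \<open>0\<close> by the
  convention \<open>x / 0 = 0\<close>, which does not affect the upper limit.\<close>

definition h_top ::
  "('g, 'm) monoid_scheme \<Rightarrow> 'x topology \<Rightarrow> ('g \<Rightarrow> 'x \<Rightarrow> 'x) \<Rightarrow> 'g set \<Rightarrow> (nat \<Rightarrow> 'g set) \<Rightarrow>
   'x set set \<Rightarrow> ereal" where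
  "h_top G X \<phi> S F \<U> =
     limsup (\<lambda>n. ereal (1 / real (card (S \<inter> F n)) *
       ln (real (cover_number X
         (common_refinement X (S \<inter> F n) (\<lambda>g. inverse_translate G \<phi> g \<U>))))))"

end

theory Submission
  imports Defs
begin

text \<open>An infinite IP-set contains a set \<open>Q\<close> of ordered finite products, with \<open>\<one>\<close> added, whose
  indicator function is a recurrent point of the shift on \<open>{0,1}\<^sup>G\<close>.  Taking the product of \<open>X\<close>
  with the orbit closure of this point shows that the hitting times
  \<open>N(A\<^sub>1, B\<^sub>1), \<dots>, N(A\<^sub>m, B\<^sub>m)\<close> of nonempty open subsets of \<open>X\<close> have infinitely many common
  elements of the form \<open>u v\<^sup>-\<^sup>1\<close> with \<open>u, v \<in> Q\<close>.  This makes it possible to find arbitrarily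
  large finite sets of independent times in the IP-set, for any finite family of nonempty open
  sets.  A union \<open>S\<close> of such sets that grow fast compared to the Folner sequence is, at infinitely
  many stages, almost entirely made of its last block, which determines the upper limit.  For the
  cover \<open>\<U>\<close>, the open sets are the interiors of the private parts of the members of \<open>\<U>\<close> in the
  admissible case, and the complements of their closures in the non-trivial case; the entropy is
  then at least \<open>ln (n / c)\<close>, where \<open>n = card \<U>\<close> and \<open>c\<close> is \<open>1\<close> or \<open>n - 1\<close>, respectively.\<close>

section \<open>Hitting times\<close>

text \<open>Bijectivity comes for free from the action laws, since \<open>\<phi> (inv g)\<close> is
  a two-sided inverse of \<open>\<phi> g\<close>.\<close>

lemma group_actionI:
  fixes G (structure)
  assumes "group G"
    and map: "\<And>g x. g \<in> carrier G \<Longrightarrow> x \<in> E \<Longrightarrow> \<phi> g x \<in> E"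
    and ext: "\<And>g. g \<in> carrier G \<Longrightarrow> \<phi> g \<in> extensional E"
    and one: "\<And>x. x \<in> E \<Longrightarrow> \<phi> \<one>\<^bsub>G\<^esub> x = x"
    and mult: "\<And>g h x. g \<in> carrier G \<Longrightarrow> h \<in> carrier G \<Longrightarrow> x \<in> E \<Longrightarrow>
      \<phi> (g \<otimes>\<^bsub>G\<^esub> h) x = \<phi> g (\<phi> h x)"
  shows "group_action G E \<phi>"
proof -
  interpret group G by fact
  have Bij: "\<phi> g \<in> Bij E" if g: "g \<in> carrier G" for g
  proof -
    have "bij_betw (\<phi> g) E E"
      by (rule bij_betw_byWitness[where f' = "\<phi> (inv g)"])
         (use g map one in \<open>auto simp flip: mult\<close>)
    then show ?thesis
      using ext[OF g] by (simp add: Bij_def)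
  qed
  have "\<phi> (a \<otimes> b) = compose E (\<phi> a) (\<phi> b)" if "a \<in> carrier G" "b \<in> carrier G" for a b
  proof
    fix x
    show "\<phi> (a \<otimes> b) x = compose E (\<phi> a) (\<phi> b) x"
      using that mult ext[of "a \<otimes> b"] by (cases "x \<in> E") (auto simp: compose_def extensional_def)
  qed
  then have "group_hom G (BijGroup E) \<phi>"
    unfolding group_hom_def group_hom_axioms_def
    using is_group group_BijGroup Bij by (auto simp: hom_def BijGroup_def)
  then show ?thesis
    by (simp add: group_action_def)
qed

section \<open>Pointwise action laws and product systems\<close>

lemma G_system_one:
  assumes "G_system G X \<phi>" "x \<in> topspace X"
  shows "\<phi> \<one>\<^bsub>G\<^esub> x = x"
  using assms group_action.id_eq_one[of G "topspace X" \<phi>]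
  unfolding G_system_def by (metis restrict_apply')

lemma G_system_mult:
  assumes "G_system G X \<phi>" "g \<in> carrier G" "h \<in> carrier G" "x \<in> topspace X"
  shows "\<phi> (g \<otimes>\<^bsub>G\<^esub> h) x = \<phi> g (\<phi> h x)"
  using assms group_action.composition_rule[of G "topspace X" \<phi>]
  unfolding G_system_def by metis

lemma G_system_openin_preimage:
  assumes "G_system G X \<phi>" "g \<in> carrier G" "openin X U"
  shows "openin X {x \<in> topspace X. \<phi> g x \<in> U}"
  using assms unfolding G_system_def continuous_map_def by blast

lemma G_system_prod:
  fixes G (structure)
  assumes G: "group G" and X: "G_system G X \<phi>" and Y: "G_system G Y \<psi>"
  shows "G_system G (prod_topology X Y) (diagonal_action X \<phi> Y \<psi>)"
  unfolding G_system_def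
proof (intro conjI ballI)
  show "compact_space (prod_topology X Y)" "metrizable_space (prod_topology X Y)"
    using X Y by (auto simp: G_system_def compact_space_prod_topology metrizable_space_prod_topology)
  interpret group G by (fact G)
  show "group_action G (topspace (prod_topology X Y)) (diagonal_action X \<phi> Y \<psi>)"
    by (rule group_actionI[OF G])
       (use G_system_in_topspace[OF X] G_system_in_topspace[OF Y] G_system_one[OF X]
         G_system_one[OF Y] G_system_mult[OF X] G_system_mult[OF Y]
        in \<open>auto simp: diagonal_action_def\<close>)
  fix g assume "g \<in> carrier G"
  then have "continuous_map (prod_topology X Y) (prod_topology X Y) (\<lambda>(x, y). (\<phi> g x, \<psi> g y))"
    using X Y by (auto simp: G_system_def continuous_map_prod_top)
  then show "continuous_map (prod_topology X Y) (prod_topology X Y) (diagonal_action X \<phi> Y \<psi> g)"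
    by (rule continuous_map_eq) (auto simp: diagonal_action_def)
qed

section \<open>Hitting times in transitive recurrent systems\<close>

definition hitting_times ::
  "('g, 'm) monoid_scheme \<Rightarrow> ('g \<Rightarrow> 'x \<Rightarrow> 'x) \<Rightarrow> 'x set \<Rightarrow> 'x set \<Rightarrow> 'g set" where
  "hitting_times G \<phi> A B = {g \<in> carrier G. \<exists>x\<in>A. \<phi> g x \<in> B}"

lemma transitive_point_visits:
  assumes "transitive_point G X \<phi> x" "openin X U" "U \<noteq> {}"
  obtains g where "g \<in> carrier G" "\<phi> g x \<in> U"
  using assms dense_intersects_open[of X "orbit G \<phi> x"]
  unfolding transitive_point_def orbit_def by blast

text \<open>Elements \<open>a\<close> and \<open>b\<close> carry a transitive recurrent point
  \<open>x\<close> into \<open>A\<close> and \<open>B\<close>. By recurrence, infinitely many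
  \<open>g\<close> bring \<open>x\<close> so close to itself that \<open>b g x\<close> is still in
  \<open>B\<close>. Each \<open>b g a\<^sup>-\<^sup>1\<close> then maps the point \<open>a x\<close>
  of \<open>A\<close> into \<open>B\<close>.\<close>

lemma infinite_hitting_times:
  fixes G (structure)
  assumes G: "group G" and X: "G_system G X \<phi>" and tr: "transitive_recurrent G X \<phi>"
    and A: "openin X A" "A \<noteq> {}" and B: "openin X B" "B \<noteq> {}"
  shows "infinite (hitting_times G \<phi> A B)"
proof -
  interpret group G by (fact G)
  obtain x where tx: "transitive_point G X \<phi> x" and rx: "recurrent_point G X \<phi> x"
    using tr unfolding transitive_recurrent_def by blast
  have x: "x \<in> topspace X"
    using tx by (simp add: transitive_point_def)
  obtain a where a: "a \<in> carrier G" "\<phi> a x \<in> A"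
    using transitive_point_visits[OF tx A] .
  obtain b where b: "b \<in> carrier G" "\<phi> b x \<in> B"
    using transitive_point_visits[OF tx B] .
  define J where "J = {g \<in> carrier G. \<phi> g x \<in> {z \<in> topspace X. \<phi> b z \<in> B}}"
  have "infinite J"
    using rx G_system_openin_preimage[OF X b(1) B(1)] b(2) x
    unfolding recurrent_point_def J_def by blast
  moreover have "inj_on (\<lambda>g. b \<otimes> g \<otimes> inv a) J"
    using a b by (auto intro!: inj_onI simp: J_def)
  ultimately have "infinite ((\<lambda>g. b \<otimes> g \<otimes> inv a) ` J)"
    by (simp add: finite_image_iff)
  moreover have "(\<lambda>g. b \<otimes> g \<otimes> inv a) ` J \<subseteq> hitting_times G \<phi> A B"
  proof
    fix k assume "k \<in> (\<lambda>g. b \<otimes> g \<otimes> inv a) ` J"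
    then obtain g where g: "g \<in> J" "k = b \<otimes> g \<otimes> inv a" by blast
    have "\<phi> k (\<phi> a x) = \<phi> (b \<otimes> g \<otimes> inv a \<otimes> a) x"
      using g a b x G_system_mult[OF X] by (simp add: J_def)
    also have "b \<otimes> g \<otimes> inv a \<otimes> a = b \<otimes> g"
      using g a b by (simp add: m_assoc J_def)
    also have "\<phi> (b \<otimes> g) x = \<phi> b (\<phi> g x)"
      using g b x G_system_mult[OF X] by (simp add: J_def)
    finally show "k \<in> hitting_times G \<phi> A B"
      using g a b unfolding hitting_times_def J_def by (auto intro!: bexI[of _ "\<phi> a x"])
  qed
  ultimately show ?thesis
    using finite_subset by blast
qed

text \<open>Witnesses live on sets of reals, as in \<open>mildly_mixing\<close>, so that mixing
  applies to them directly. The purpose of the notion is its stability: the intersection with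
  hitting times of a mildly mixing system stays in the class.\<close>

definition contains_hitting_times :: "('g, 'm) monoid_scheme \<Rightarrow> 'g set \<Rightarrow> bool" where
  "contains_hitting_times G M \<longleftrightarrow>
     (\<exists>(Z :: real topology) \<zeta> C D. G_system G Z \<zeta> \<and> transitive_recurrent G Z \<zeta> \<and>
        openin Z C \<and> C \<noteq> {} \<and> openin Z D \<and> D \<noteq> {} \<and> hitting_times G \<zeta> C D \<subseteq> M)"

text \<open>The system is copied onto a set of reals, and the open sets are pulled back along the
  inverse \<open>h\<close> of the copying map. Equivariance of \<open>h\<close> turns hitting times
  of the copy into hitting times of the original.\<close>

lemma contains_hitting_timesI:
  fixes Y :: "'y topology"
  assumes Y: "G_system G Y \<psi>" and tr: "transitive_recurrent G Y \<psi>"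
    and C: "openin Y C" "C \<noteq> {}" and D: "openin Y D" "D \<noteq> {}"
    and M: "hitting_times G \<psi> C D \<subseteq> M"
  shows "contains_hitting_times G M"
proof -
  obtain Z :: "real topology" and \<zeta> f h where Z: "G_system G Z \<zeta>"
    and hom: "homeomorphic_maps Y Z f h"
    and f: "\<And>g y. g \<in> carrier G \<Longrightarrow> y \<in> topspace Y \<Longrightarrow> f (\<psi> g y) = \<zeta> g (f y)"
    and h: "\<And>g z. g \<in> carrier G \<Longrightarrow> z \<in> topspace Z \<Longrightarrow> h (\<zeta> g z) = \<psi> g (h z)"
    using G_system_real_copy[OF Y] by blast
  have cf: "continuous_map Y Z f" and ch: "continuous_map Z Y h"
    and hf: "\<And>y. y \<in> topspace Y \<Longrightarrow> h (f y) = y" and fh: "\<And>z. z \<in> topspace Z \<Longrightarrow> f (h z) = z"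
    using hom by (simp_all add: homeomorphic_maps_def)
  have fT: "f y \<in> topspace Z" if "y \<in> topspace Y" for y
    using cf that by (auto simp: continuous_map_def)
  have hT: "h z \<in> topspace Y" if "z \<in> topspace Z" for z
    using ch that by (auto simp: continuous_map_def)
  have "f ` topspace Y = topspace Z"
    using fT hT fh by (force simp: image_iff)
  then have trZ: "transitive_recurrent G Z \<zeta>"
    using transitive_recurrent_factor[of G Y \<psi> Z f \<zeta>] G_system_in_topspace[OF Y] cf f tr by blast
  define P where "P U = {z \<in> topspace Z. h z \<in> U}" for U
  have P: "openin Z (P U)" "P U \<noteq> {}" if U: "openin Y U" "U \<noteq> {}" for U
  proof -
    show "openin Z (P U)"
      using ch U by (simp add: continuous_map_def P_def)
    obtain u where "u \<in> U" "u \<in> topspace Y"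
      using U openin_subset by blast
    then show "P U \<noteq> {}"
      using fT[of u] hf[of u] by (auto simp: P_def intro!: exI[of _ "f u"])
  qed
  have "hitting_times G \<zeta> (P C) (P D) \<subseteq> hitting_times G \<psi> C D"
  proof
    fix g assume "g \<in> hitting_times G \<zeta> (P C) (P D)"
    then obtain z where "g \<in> carrier G" "z \<in> P C" "\<zeta> g z \<in> P D"
      by (auto simp: hitting_times_def)
    then show "g \<in> hitting_times G \<psi> C D"
      using h[of g z] by (auto simp: hitting_times_def P_def intro!: bexI[of _ "h z"])
  qed
  then show ?thesis
    unfolding contains_hitting_times_def using Z trZ P C D M by (meson subset_trans)
qed

lemma contains_hitting_times_infinite:
  assumes "group G" "contains_hitting_times G M"
  shows "infinite M"
  using assms infinite_hitting_times finite_subset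
  unfolding contains_hitting_times_def by metis

text \<open>The product of \<open>X\<close> with the witness for \<open>M\<close> is transitive
  recurrent by mild mixing, and a time that moves a point of \<open>A \<times> C\<close> into
  \<open>B \<times> D\<close> does so in both coordinates.\<close>

lemma mildly_mixing_Int_hitting_times:
  assumes G: "group G" and X: "G_system G X \<phi>" and mm: "mildly_mixing G X \<phi>"
    and M: "contains_hitting_times G M"
    and A: "openin X A" "A \<noteq> {}" and B: "openin X B" "B \<noteq> {}"
  shows "contains_hitting_times G (M \<inter> hitting_times G \<phi> A B)"
proof -
  obtain Z :: "real topology" and \<zeta> C D where Z: "G_system G Z \<zeta>" "transitive_recurrent G Z \<zeta>"
    and C: "openin Z C" "C \<noteq> {}" and D: "openin Z D" "D \<noteq> {}"
    and CD: "hitting_times G \<zeta> C D \<subseteq> M"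
    using M unfolding contains_hitting_times_def by blast
  show ?thesis
  proof (rule contains_hitting_timesI[OF G_system_prod[OF G X Z(1)]])
    show "transitive_recurrent G (prod_topology X Z) (diagonal_action X \<phi> Z \<zeta>)"
      using mm Z unfolding mildly_mixing_def by blast
    show "openin (prod_topology X Z) (A \<times> C)" "openin (prod_topology X Z) (B \<times> D)"
      using A B C D by (simp_all add: openin_prod_Times_iff)
    show "A \<times> C \<noteq> {}" "B \<times> D \<noteq> {}"
      using A B C D by auto
    show "hitting_times G (diagonal_action X \<phi> Z \<zeta>) (A \<times> C) (B \<times> D) \<subseteq> M \<inter> hitting_times G \<phi> A B"
    proof
      fix g assume "g \<in> hitting_times G (diagonal_action X \<phi> Z \<zeta>) (A \<times> C) (B \<times> D)"
      then obtain x z where g: "g \<in> carrier G" and xz: "x \<in> A" "z \<in> C"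
        and d: "diagonal_action X \<phi> Z \<zeta> g (x, z) \<in> B \<times> D"
        by (auto simp: hitting_times_def)
      have "x \<in> topspace X" "z \<in> topspace Z"
        using xz A C openin_subset by blast+
      then have "\<phi> g x \<in> B" "\<zeta> g z \<in> D"
        using d by (simp_all add: diagonal_action_def)
      then show "g \<in> M \<inter> hitting_times G \<phi> A B"
        using CD g xz unfolding hitting_times_def by blast
    qed
  qed
qed

lemma mildly_mixing_INT_hitting_times:
  assumes G: "group G" and X: "G_system G X \<phi>" and mm: "mildly_mixing G X \<phi>"
    and M: "contains_hitting_times G M" and "finite I"
    and A: "\<And>i. i \<in> I \<Longrightarrow> openin X (A i) \<and> A i \<noteq> {}"
    and B: "\<And>i. i \<in> I \<Longrightarrow> openin X (B i) \<and> B i \<noteq> {}"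
  shows "contains_hitting_times G (M \<inter> (\<Inter>i\<in>I. hitting_times G \<phi> (A i) (B i)))"
  using \<open>finite I\<close> A B
proof (induction I rule: finite_induct)
  case empty
  then show ?case using M by simp
next
  case (insert i I)
  then have "contains_hitting_times G (M \<inter> (\<Inter>i\<in>I. hitting_times G \<phi> (A i) (B i)) \<inter>
      hitting_times G \<phi> (A i) (B i))"
    by (intro mildly_mixing_Int_hitting_times[OF G X mm]) auto
  moreover have "M \<inter> (\<Inter>i\<in>I. hitting_times G \<phi> (A i) (B i)) \<inter> hitting_times G \<phi> (A i) (B i)
      = M \<inter> (\<Inter>i\<in>insert i I. hitting_times G \<phi> (A i) (B i))"
    by auto
  ultimately show ?case by simp
qed

section \<open>Recurrent sets\<close>

text \<open>The function \<open>t \<mapsto> (t \<in> Q)\<close> is a recurrent point of the shift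
  \<open>(g y) t = y (t g)\<close> if and only if \<open>Q\<close> is recurrent in the following sense.\<close>

definition recurrent_set :: "('g, 'm) monoid_scheme \<Rightarrow> 'g set \<Rightarrow> bool" where
  "recurrent_set G Q \<longleftrightarrow>
     (\<forall>K. finite K \<longrightarrow> K \<subseteq> carrier G \<longrightarrow>
        infinite {g \<in> carrier G. \<forall>t\<in>K. t \<otimes>\<^bsub>G\<^esub> g \<in> Q \<longleftrightarrow> t \<in> Q})"

text \<open>The witness is the orbit closure of the indicator \<open>q\<close> of \<open>Q\<close>
  under the shift, with both open sets equal to the cylinder \<open>y \<one> = True\<close>. If
  \<open>y\<close> and \<open>g y\<close> lie in it, then \<open>y\<close> is true at
  \<open>\<one>\<close> and at \<open>g\<close>. Some orbit point \<open>h q\<close> near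
  \<open>y\<close> shares this, which says that \<open>h\<close> and \<open>g h\<close> are in
  \<open>Q\<close>.\<close>

lemma recurrent_set_quotients:
  fixes G (structure)
  assumes G: "group G" and "countable (carrier G)"
    and Q: "recurrent_set G Q" "\<one>\<^bsub>G\<^esub> \<in> Q"
  shows "contains_hitting_times G
    {g \<in> carrier G. \<exists>h\<in>carrier G. h \<in> Q \<and> g \<otimes>\<^bsub>G\<^esub> h \<in> Q}"
proof -
  interpret group G by (fact G)
  define P where "P = product_topology (\<lambda>_. discrete_topology (UNIV :: bool set)) (carrier G)"
  have topP: "topspace P = extensional (carrier G)"
    by (auto simp: P_def PiE_def)
  \<comment> \<open>Translating the argument on the right makes this a left action:
    \<open>\<sigma> g (\<sigma> h y)\<close> at \<open>t\<close> is
    \<open>y (t g h)\<close>.\<close>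
  define \<sigma> where "\<sigma> g y = (\<lambda>t\<in>carrier G. y (t \<otimes> g))" for g and y :: "'a \<Rightarrow> bool"
  define q where "q = (\<lambda>t\<in>carrier G. t \<in> Q)"
  define Orb where "Orb = (\<lambda>g. \<sigma> g q) ` carrier G"
  define T where "T = P closure_of Orb"
  define Y where "Y = subtopology P T"
  define \<psi> where "\<psi> g = restrict (\<sigma> g) T" for g
  have \<sigma>_mult: "\<sigma> (g \<otimes> h) y = \<sigma> g (\<sigma> h y)" if "g \<in> carrier G" "h \<in> carrier G" for g h y
    using that by (auto simp: \<sigma>_def fun_eq_iff m_assoc)
  have \<sigma>_cont: "continuous_map P P (\<sigma> g)" if "g \<in> carrier G" for g
    unfolding P_def \<sigma>_def
    by (subst continuous_map_componentwise)
       (use that in \<open>auto intro!: continuous_map_product_projection\<close>)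
  have TP: "T \<subseteq> topspace P"
    by (simp add: T_def closure_of_subset_topspace)
  have topY: "topspace Y = T"
    using TP by (auto simp: Y_def)
  have OP: "Orb \<subseteq> topspace P"
    by (auto simp: Orb_def topP \<sigma>_def)
  then have OT: "Orb \<subseteq> T"
    by (simp add: T_def closure_of_subset)
  have \<sigma>Orb: "\<sigma> g ` Orb \<subseteq> Orb" if "g \<in> carrier G" for g
    using that by (auto simp: Orb_def simp flip: \<sigma>_mult)
  have \<sigma>T: "\<sigma> g y \<in> T" if "g \<in> carrier G" "y \<in> T" for g y
    using continuous_map_image_closure_subset[OF \<sigma>_cont[OF that(1)], of Orb]
      closure_of_mono[OF \<sigma>Orb[OF that(1)], of P] that(2) by (auto simp: T_def)
  have \<sigma>q: "\<sigma> \<one> q = q"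
    by (auto simp: \<sigma>_def q_def intro!: restrict_ext)
  then have qO: "q \<in> Orb"
    unfolding Orb_def by (metis imageI one_closed)
  have sys: "G_system G Y \<psi>"
    unfolding G_system_def
  proof (intro conjI ballI)
    have "compact_space P"
      by (simp add: P_def compact_space_product_topology compact_space_discrete_topology)
    then show "compact_space Y"
      unfolding Y_def T_def
      by (meson closedin_closure_of closedin_compact_space compact_space_subtopology)
    have "metrizable_space P"
      using assms(2)
      by (auto simp: P_def metrizable_space_product_topology metrizable_space_discrete_topology
          intro: countable_subset[of _ "carrier G"])
    then show "metrizable_space Y"
      by (simp add: Y_def metrizable_space_subtopology)
    show "group_action G (topspace Y) \<psi>"
      unfolding topY
      by (rule group_actionI[OF G])
         (use \<sigma>T TP \<sigma>_mult in \<open>auto simp: \<psi>_def topP \<sigma>_def extensional_def fun_eq_iff\<close>)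
    fix g assume g: "g \<in> carrier G"
    have "continuous_map Y Y (\<sigma> g)"
      unfolding Y_def using \<sigma>_cont[OF g] \<sigma>T[OF g]
      by (auto simp: continuous_map_in_subtopology continuous_map_from_subtopology)
    then show "continuous_map Y Y (\<psi> g)"
      by (rule continuous_map_eq) (simp add: \<psi>_def topY)
  qed
  have orb: "orbit G \<psi> q = Orb"
    using qO OT by (auto simp: orbit_def \<psi>_def Orb_def)
  have tp: "transitive_point G Y \<psi> q"
    unfolding transitive_point_def orb topY
    using qO OT by (auto simp: Y_def closure_of_subtopology T_def Int_absorb1)
  have rp: "infinite {g \<in> carrier G. \<psi> g q \<in> U}" if U: "openin Y U" "q \<in> U" for U
  proof -
    obtain W where W: "openin P W" "U = W \<inter> T"
      using U(1) unfolding Y_def openin_subtopology by blast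
    have "q \<in> W" using U W by blast
    \<comment> \<open>A basic neighbourhood of \<open>q\<close> constrains only finitely many
      coordinates. They form the finite set \<open>K\<close> to which recurrence of \<open>Q\<close>
      is applied.\<close>
    then obtain V where V: "finite {i \<in> carrier G. V i \<noteq> UNIV}" "q \<in> Pi\<^sub>E (carrier G) V"
        "Pi\<^sub>E (carrier G) V \<subseteq> W"
      using W(1) unfolding P_def openin_product_topology_alt by force
    define K where "K = {i \<in> carrier G. V i \<noteq> UNIV}"
    have "{g \<in> carrier G. \<forall>t\<in>K. t \<otimes> g \<in> Q \<longleftrightarrow> t \<in> Q} \<subseteq> {g \<in> carrier G. \<psi> g q \<in> U}"
    proof clarify
      fix g assume g: "g \<in> carrier G" and K: "\<forall>t\<in>K. t \<otimes> g \<in> Q \<longleftrightarrow> t \<in> Q"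
      have "\<sigma> g q t \<in> V t" if t: "t \<in> carrier G" for t
      proof (cases "t \<in> K")
        case True
        then have "\<sigma> g q t = q t"
          using K t g by (simp add: \<sigma>_def q_def)
        then show ?thesis using V(2) t by auto
      qed (use t in \<open>simp add: K_def\<close>)
      then have "\<sigma> g q \<in> Pi\<^sub>E (carrier G) V"
        by (auto simp: \<sigma>_def)
      then show "\<psi> g q \<in> U"
        using V(3) W(2) qO OT \<sigma>T[OF g] by (auto simp: \<psi>_def)
    qed
    moreover have "infinite {g \<in> carrier G. \<forall>t\<in>K. t \<otimes> g \<in> Q \<longleftrightarrow> t \<in> Q}"
      using Q(1) V(1) unfolding recurrent_set_def K_def by auto
    ultimately show ?thesis
      using finite_subset by blast
  qed
  have tr: "transitive_recurrent G Y \<psi>"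
    unfolding transitive_recurrent_def recurrent_point_def
    using tp rp by (auto simp: transitive_point_def)
  define C where "C g = {y \<in> topspace Y. y g}" for g
  have C: "openin Y (C g)" if "g \<in> carrier G" for g
  proof -
    have "continuous_map Y (discrete_topology UNIV) (\<lambda>y. y g)"
      unfolding Y_def P_def
      by (intro continuous_map_from_subtopology continuous_map_product_projection that)
    then show ?thesis
      by (auto simp: continuous_map_def C_def dest: spec[of _ "{True}"])
  qed
  have "q \<in> C \<one>"
    using qO OT topY Q(2) by (auto simp: C_def q_def)
  then have C1: "C \<one> \<noteq> {}" by blast
  show ?thesis
  proof (rule contains_hitting_timesI[OF sys tr C[OF one_closed] C1 C[OF one_closed] C1], rule subsetI)
    fix g assume "g \<in> hitting_times G \<psi> (C \<one>) (C \<one>)"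
    then obtain y where g: "g \<in> carrier G" and y: "y \<in> C \<one>" "\<psi> g y \<in> C \<one>"
      by (auto simp: hitting_times_def)
    have "y \<in> C \<one> \<inter> C g"
      using y g by (auto simp: C_def topY \<psi>_def \<sigma>_def)
    \<comment> \<open>The point \<open>y\<close> is only in the closure of the orbit, but the open
      set \<open>C \<one> \<inter> C g\<close> around it contains a point of the orbit
      itself.\<close>
    then obtain h where h: "h \<in> carrier G" "\<psi> h q \<in> C \<one> \<inter> C g"
      using transitive_point_visits[OF tp, of "C \<one> \<inter> C g"] C g by blast
    then have "h \<in> Q" "g \<otimes> h \<in> Q"
      using g qO OT by (auto simp: C_def \<psi>_def \<sigma>_def q_def)
    then show "g \<in> {g \<in> carrier G. \<exists>h\<in>carrier G. h \<in> Q \<and> g \<otimes> h \<in> Q}"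
      using g h by blast
  qed
qed

section \<open>Finite products\<close>

text \<open>Unlike in \<open>finite_products\<close>, the empty product is allowed and the indices
  are confined to \<open>I\<close>; tracking index sets shows when two products may be
  concatenated.\<close>

definition ordered_products :: "('g, 'm) monoid_scheme \<Rightarrow> (nat \<Rightarrow> 'g) \<Rightarrow> nat set \<Rightarrow> 'g set" where
  "ordered_products G p I =
     {foldr (\<lambda>i a. p i \<otimes>\<^bsub>G\<^esub> a) ns \<one>\<^bsub>G\<^esub> | ns. sorted_wrt (<) ns \<and> set ns \<subseteq> I}"

lemma ordered_products_mono: "I \<subseteq> J \<Longrightarrow> ordered_products G p I \<subseteq> ordered_products G p J"
  unfolding ordered_products_def by blast

lemma one_in_ordered_products: "\<one>\<^bsub>G\<^esub> \<in> ordered_products G p I"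
  unfolding ordered_products_def by (auto intro!: exI[of _ "[]"])

lemma finite_ordered_products:
  assumes "finite I"
  shows "finite (ordered_products G p I)"
proof -
  have "{ns. sorted_wrt (<) ns \<and> set ns \<subseteq> I} \<subseteq> {ns. set ns \<subseteq> I \<and> distinct ns}"
    using strict_sorted_iff by blast
  moreover have "finite {ns. set ns \<subseteq> I \<and> distinct ns}"
    using finite_subset_distinct[OF assms] by (simp add: conj_commute)
  ultimately have "finite {ns. sorted_wrt (<) ns \<and> set ns \<subseteq> I}"
    by (rule finite_subset)
  moreover have "ordered_products G p I =
      (\<lambda>ns. foldr (\<lambda>i a. p i \<otimes>\<^bsub>G\<^esub> a) ns \<one>\<^bsub>G\<^esub>) ` {ns. sorted_wrt (<) ns \<and> set ns \<subseteq> I}"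
    unfolding ordered_products_def by blast
  ultimately show ?thesis
    by simp
qed

lemma ordered_products_bounded:
  assumes "x \<in> ordered_products G p {N..}"
  obtains M where "N \<le> M" "x \<in> ordered_products G p {N..<M}"
proof -
  obtain ns where ns: "x = foldr (\<lambda>i a. p i \<otimes>\<^bsub>G\<^esub> a) ns \<one>\<^bsub>G\<^esub>" "sorted_wrt (<) ns" "set ns \<subseteq> {N..}"
    using assms unfolding ordered_products_def by blast
  \<comment> \<open>Inserting \<open>N\<close> keeps the maximum defined for the empty list and
    guarantees that the bound is at least \<open>N\<close>.\<close>
  have "set ns \<subseteq> {N..<Max (insert N (set ns)) + 1}"
    using ns(3) by (auto simp: less_Suc_eq_le)
  then show thesis
    using that[of "Max (insert N (set ns)) + 1"] ns(1,2) unfolding ordered_products_def by force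
qed

lemma ordered_products_UNIV: "ordered_products G p UNIV = insert \<one>\<^bsub>G\<^esub> (finite_products G p)"
proof (intro equalityI subsetI)
  fix x assume "x \<in> ordered_products G p UNIV"
  then obtain ns where "x = foldr (\<lambda>i a. p i \<otimes>\<^bsub>G\<^esub> a) ns \<one>\<^bsub>G\<^esub>" "sorted_wrt (<) ns"
    unfolding ordered_products_def by blast
  then show "x \<in> insert \<one>\<^bsub>G\<^esub> (finite_products G p)"
    by (cases "ns = []") (auto simp: finite_products_def)
next
  fix x assume "x \<in> insert \<one>\<^bsub>G\<^esub> (finite_products G p)"
  then show "x \<in> ordered_products G p UNIV"
    using one_in_ordered_products[of G p UNIV]
    by (auto simp: finite_products_def ordered_products_def)
qed

section \<open>Concatenation of ordered products and recurrent subsets\<close>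

context group
begin

lemma foldr_mult_closed:
  assumes "range p \<subseteq> carrier G"
  shows "foldr (\<lambda>i a. p i \<otimes> a) ns \<one> \<in> carrier G"
  using assms by (induction ns) auto

lemma foldr_mult_append:
  assumes "range p \<subseteq> carrier G"
  shows "foldr (\<lambda>i a. p i \<otimes> a) (ms @ ns) \<one> =
    foldr (\<lambda>i a. p i \<otimes> a) ms \<one> \<otimes> foldr (\<lambda>i a. p i \<otimes> a) ns \<one>"
proof (induction ms)
  case Nil
  then show ?case using foldr_mult_closed[OF assms] by simp
next
  case (Cons m ms)
  have "p m \<in> carrier G" using assms by blast
  then show ?case
    using Cons foldr_mult_closed[OF assms] by (simp add: m_assoc del: foldr_append)
qed

lemma ordered_products_subset_carrier:
  assumes "range p \<subseteq> carrier G"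
  shows "ordered_products G p I \<subseteq> carrier G"
  unfolding ordered_products_def using foldr_mult_closed[OF assms] by blast

lemma ordered_products_mult:
  assumes p: "range p \<subseteq> carrier G" and x: "x \<in> ordered_products G p I"
    and y: "y \<in> ordered_products G p J" and less: "\<And>i j. i \<in> I \<Longrightarrow> j \<in> J \<Longrightarrow> i < j"
  shows "x \<otimes> y \<in> ordered_products G p (I \<union> J)"
proof -
  obtain ms where ms: "x = foldr (\<lambda>i a. p i \<otimes> a) ms \<one>" "sorted_wrt (<) ms" "set ms \<subseteq> I"
    using x unfolding ordered_products_def by blast
  obtain ns where ns: "y = foldr (\<lambda>i a. p i \<otimes> a) ns \<one>" "sorted_wrt (<) ns" "set ns \<subseteq> J"
    using y unfolding ordered_products_def by blast
  have "sorted_wrt (<) (ms @ ns)" "set (ms @ ns) \<subseteq> I \<union> J"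
    using ms ns less by (auto simp: sorted_wrt_append)
  moreover have "x \<otimes> y = foldr (\<lambda>i a. p i \<otimes> a) (ms @ ns) \<one>"
    unfolding ms(1) ns(1) foldr_mult_append[OF p] ..
  ultimately show ?thesis
    unfolding ordered_products_def by blast
qed

text \<open>Cutting the index list at \<open>N\<close> writes each product as one of finitely many
  initial products times a tail product, so finitely many tails would give finitely many
  products.\<close>

lemma infinite_ordered_products_tail:
  assumes p: "range p \<subseteq> carrier G" and inf: "infinite (ordered_products G p UNIV)"
  shows "infinite (ordered_products G p {N..})"
proof
  assume "finite (ordered_products G p {N..})"
  then have "finite ((\<lambda>(x, y). x \<otimes> y) ` (ordered_products G p {..<N} \<times> ordered_products G p {N..}))"
    using finite_ordered_products[of "{..<N}" G p] by blast
  moreover have "ordered_products G p UNIV \<subseteq>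
      (\<lambda>(x, y). x \<otimes> y) ` (ordered_products G p {..<N} \<times> ordered_products G p {N..})"
  proof
    fix x assume "x \<in> ordered_products G p UNIV"
    then obtain ns where ns: "x = foldr (\<lambda>i a. p i \<otimes> a) ns \<one>" "sorted_wrt (<) ns"
      unfolding ordered_products_def by blast
    define ms ks where "ms = takeWhile (\<lambda>i. i < N) ns" and "ks = dropWhile (\<lambda>i. i < N) ns"
    have "set ms \<subseteq> {..<N}"
      unfolding ms_def using set_takeWhileD by fastforce
    have split: "ns = ms @ ks"
      by (simp add: ms_def ks_def)
    then have sorted: "sorted_wrt (<) ms" "sorted_wrt (<) ks"
      using ns(2) by (metis sorted_wrt_append)+
    have "set ks \<subseteq> {N..}"
    proof (cases ks)
      case (Cons k ks')
      then have "N \<le> k"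
        unfolding ks_def using dropWhile_eq_Cons_conv[of "\<lambda>i. i < N" ns k ks'] by simp
      then show ?thesis
        using sorted(2) Cons by auto
    qed simp
    then show "x \<in> (\<lambda>(x, y). x \<otimes> y) ` (ordered_products G p {..<N} \<times> ordered_products G p {N..})"
      using \<open>set ms \<subseteq> {..<N}\<close> sorted ns(1) foldr_mult_append[OF p, of ms ks]
      unfolding split ordered_products_def by (auto simp: image_iff)
  qed
  ultimately show False
    using inf finite_subset by blast
qed

text \<open>The set is the union of \<open>A 0 = {\<one>}\<close> and \<open>A (n + 1) = A n \<union> A n q\<^sub>n\<close>, where \<open>q\<^sub>n\<close> is
  a product of terms of \<open>p\<close> with larger indices than those used in \<open>A n\<close>.  Choosing \<open>q\<^sub>n\<close>
  outside a finite set of forbidden values, which includes all \<open>a\<^sup>-\<^sup>1 t b\<close> with \<open>a, b \<in> A n\<close>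
  and \<open>t \<in> K n\<close> for an exhaustion \<open>K\<close> of the group, makes sure that \<open>t q\<^sub>m\<close> never enters
  the union unless \<open>t\<close> belongs to it.\<close>

lemma recurrent_subset_of_ordered_products:
  assumes cnt: "countable (carrier G)" and p: "range p \<subseteq> carrier G"
    and inf: "infinite (ordered_products G p UNIV)"
  obtains Q where "Q \<subseteq> ordered_products G p {N..}" "\<one> \<in> Q" "recurrent_set G Q"
proof -
  \<comment> \<open>Because \<open>\<one>\<close> belongs to every \<open>K n\<close>, all of
    \<open>A n\<close> is forbidden for \<open>q n\<close>; this is what makes \<open>q\<close>
    injective.\<close>
  define K where "K n = insert \<one> (from_nat_into (carrier G) ` {..n})" for n :: nat
  have K: "finite (K n)" "\<one> \<in> K n" "K n \<subseteq> carrier G" for n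
    using from_nat_into[of "carrier G"] one_closed by (auto simp: K_def)
  have K_mono: "K m \<subseteq> K n" if "m \<le> n" for m n
    using that by (auto simp: K_def)
  have K_ex: "\<exists>n. t \<in> K n" if "t \<in> carrier G" for t
    using from_nat_into_surj[OF cnt that] by (auto simp: K_def)
  \<comment> \<open>The first kind of value excludes \<open>t q\<^sub>m = a q\<^sub>j\<close> for
    \<open>m < j\<close>, with \<open>b = q\<^sub>m\<close>. The second kind excludes that
    \<open>t q\<^sub>m\<close> already lies in \<open>A m\<close>.\<close>
  define forbidden where "forbidden n A =
      (\<lambda>(a, t, b). inv a \<otimes> t \<otimes> b) ` (A \<times> K n \<times> A) \<union> (\<lambda>(t, a). inv t \<otimes> a) ` (K n \<times> A)"
    for n and A :: "'a set"
  \<comment> \<open>A stage records its set together with a bound \<open>M\<close> on the indices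
    used so far. The next factor takes its indices from \<open>M\<close> on, so right multiplication
    by it keeps the products ordered.\<close>
  define P where "P = (\<lambda>(n :: nat) (A, M). finite A \<and> \<one> \<in> A \<and> N \<le> M \<and>
      A \<subseteq> ordered_products G p {N..<M})"
  define R where "R = (\<lambda>n (A, M :: nat) (A', M' :: nat).
      \<exists>g\<in>carrier G - forbidden n A. A' = A \<union> (\<lambda>a. a \<otimes> g) ` A)"
  have "\<exists>f. \<forall>n. P n (f n) \<and> R n (f n) (f (Suc n))"
  proof (rule dependent_nat_choice)
    show "\<exists>x. P 0 x"
      by (rule exI[of _ "({\<one>}, N)"]) (simp add: P_def one_in_ordered_products)
    fix x n assume Px: "P n x"
    obtain A M where x: "x = (A, M)" by force
    have A: "finite A" "\<one> \<in> A" "N \<le> M" "A \<subseteq> ordered_products G p {N..<M}"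
      using Px by (auto simp: P_def x)
    have "finite (forbidden n A)"
      using A(1) K(1) by (simp add: forbidden_def)
    then obtain g where g: "g \<in> ordered_products G p {M..}" "g \<notin> forbidden n A"
      using infinite_ordered_products_tail[OF p inf, of M] by (meson finite_subset subsetI)
    obtain M' where M': "M \<le> M'" "g \<in> ordered_products G p {M..<M'}"
      using ordered_products_bounded[OF g(1)] .
    have "a \<otimes> g \<in> ordered_products G p {N..<M'}" if "a \<in> A" for a
      using ordered_products_mult[OF p _ M'(2), of a "{N..<M}"] A(3,4) M'(1) that
      by (auto simp: ivl_disj_un_two)
    moreover have "ordered_products G p {N..<M} \<subseteq> ordered_products G p {N..<M'}"
      using M'(1) by (intro ordered_products_mono) auto
    ultimately have "P (Suc n) (A \<union> (\<lambda>a. a \<otimes> g) ` A, M')"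
      using A M'(1) by (auto simp: P_def)
    moreover have "R n x (A \<union> (\<lambda>a. a \<otimes> g) ` A, M')"
      using g ordered_products_subset_carrier[OF p] by (auto simp: R_def x)
    ultimately show "\<exists>y. P (Suc n) y \<and> R n x y"
      by blast
  qed
  then obtain f where f: "\<And>n. P n (f n)" "\<And>n. R n (f n) (f (Suc n))"
    by blast
  define A where "A n = fst (f n)" for n
  have A1: "\<one> \<in> A n" and A_sub: "A n \<subseteq> ordered_products G p {N..<snd (f n)}" for n
    using f(1)[of n] by (auto simp: P_def A_def split: prod.splits)
  have "\<exists>g. g \<in> carrier G - forbidden n (A n) \<and> A (Suc n) = A n \<union> (\<lambda>a. a \<otimes> g) ` A n" for n
    using f(2)[of n] by (auto simp: R_def A_def split: prod.splits)
  then obtain q where q: "\<And>n. q n \<in> carrier G - forbidden n (A n)"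
    and A_Suc: "\<And>n. A (Suc n) = A n \<union> (\<lambda>a. a \<otimes> q n) ` A n"
    by metis
  have qc: "q n \<in> carrier G" for n
    using q by blast
  have q1: "q n \<noteq> inv a \<otimes> t \<otimes> b" if "a \<in> A n" "t \<in> K n" "b \<in> A n" for a t b n
    using q[of n] that by (force simp: forbidden_def)
  have q2: "q n \<noteq> inv t \<otimes> a" if "a \<in> A n" "t \<in> K n" for a t n
    using q[of n] that by (force simp: forbidden_def)
  have A_mono: "A m \<subseteq> A n" if "m \<le> n" for m n
    using lift_Suc_mono_le[of A m n] that A_Suc by blast
  have Ac: "A n \<subseteq> carrier G" for n
    using A_sub ordered_products_subset_carrier[OF p] by blast
  define Q where "Q = (\<Union>n. A n)"
  have qA: "q m \<in> A (Suc m)" for m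
    unfolding A_Suc using A1[of m] qc[of m] by force
  \<comment> \<open>\<open>A n\<close> contains every earlier \<open>q m\<close>, and
    \<open>q n\<close> avoids \<open>A n\<close>. Distinctness is what yields infinitely many return
    times.\<close>
  have inj: "q m \<noteq> q n" if "m < n" for m n
  proof -
    have "q m \<in> A n"
      using qA A_mono[of "Suc m" n] that by auto
    then have "q n \<noteq> inv \<one> \<otimes> q m"
      using q2 K(2) by blast
    then show ?thesis
      using qc by simp
  qed
  then have "inj q"
    by (metis injI linorder_neqE_nat)
  have ret: "eventually (\<lambda>m. t \<otimes> q m \<in> Q \<longleftrightarrow> t \<in> Q) sequentially" if t: "t \<in> carrier G" for t
  proof (cases "t \<in> Q")
    case True
    then obtain n where n: "t \<in> A n"
      unfolding Q_def by blast
    have "t \<otimes> q m \<in> Q" if "m \<ge> n" for m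
    proof -
      have "t \<otimes> q m \<in> A (Suc m)"
        using n A_mono[OF that] by (auto simp: A_Suc)
      then show ?thesis
        by (auto simp: Q_def)
    qed
    then show ?thesis
      unfolding eventually_sequentially using True by blast
  next
    case False
    obtain n where n: "t \<in> K n"
      using K_ex[OF t] by blast
    \<comment> \<open>Induction over the stages: up to stage \<open>m\<close> the second kind of
      forbidden value excludes membership. At stage \<open>m + 1\<close> a new element
      \<open>a q\<^sub>m\<close> would cancel to \<open>t = a\<close>, which is in \<open>Q\<close>.
      Later new elements \<open>a q\<^sub>j\<close> are excluded by the first kind. The bound
      \<open>n \<le> m\<close> puts \<open>t\<close> into the relevant sets
      \<open>K\<close>.\<close>
    have "t \<otimes> q m \<notin> A j" if m: "m \<ge> n" for m j
    proof (induction j)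
      case base: 0
      show ?case
      proof
        assume "t \<otimes> q m \<in> A 0"
        then have "t \<otimes> q m \<in> A m"
          using A_mono[of 0 m] by auto
        then have "q m \<noteq> inv t \<otimes> (t \<otimes> q m)"
          using q2 n K_mono[OF m] by blast
        then show False
          using t qc by (simp add: m_assoc[symmetric])
      qed
    next
      case (Suc j)
      show ?case
      proof
        assume *: "t \<otimes> q m \<in> A (Suc j)"
        consider "Suc j \<le> m" | "j = m" | "m < j"
          by linarith
        then show False
        proof cases
          case 1
          then have "t \<otimes> q m \<in> A m"
            using A_mono * by blast
          then have "q m \<noteq> inv t \<otimes> (t \<otimes> q m)"
            using q2 n K_mono[OF m] by blast
          then show False
            using t qc by (simp add: m_assoc[symmetric])
        next
          case 2
          then obtain a where "a \<in> A m" "t \<otimes> q m = a \<otimes> q m"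
            using * Suc by (auto simp: A_Suc)
          then have "t \<in> A m"
            using t qc Ac by (metis right_cancel subsetD)
          then show False
            using False by (auto simp: Q_def)
        next
          case 3
          then obtain a where a: "a \<in> A j" "t \<otimes> q m = a \<otimes> q j"
            using * Suc by (auto simp: A_Suc)
          have ac: "a \<in> carrier G"
            using a Ac by blast
          have "q j = inv a \<otimes> (a \<otimes> q j)"
            using ac qc by (simp add: m_assoc[symmetric])
          also have "\<dots> = inv a \<otimes> t \<otimes> q m"
            using ac qc t a(2) by (simp add: m_assoc)
          finally show False
            using q1[OF a(1), of t "q m"] n K_mono[of n j] qA[of m] A_mono[of "Suc m" j] 3 m
            by auto
        qed
      qed
    qed
    then show ?thesis
      unfolding eventually_sequentially using False by (auto simp: Q_def)
  qed
  have "recurrent_set G Q"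
    unfolding recurrent_set_def
  proof (intro allI impI)
    fix L assume L: "finite L" "L \<subseteq> carrier G"
    have "eventually (\<lambda>m. \<forall>t\<in>L. t \<otimes> q m \<in> Q \<longleftrightarrow> t \<in> Q) sequentially"
      using L ret by (intro eventually_ball_finite) auto
    then obtain m where m: "\<And>k t. k \<ge> m \<Longrightarrow> t \<in> L \<Longrightarrow> t \<otimes> q k \<in> Q \<longleftrightarrow> t \<in> Q"
      unfolding eventually_sequentially by blast
    have "q ` {m..} \<subseteq> {g \<in> carrier G. \<forall>t\<in>L. t \<otimes> g \<in> Q \<longleftrightarrow> t \<in> Q}"
      using m qc by auto
    moreover have "infinite (q ` {m..})"
      using \<open>inj q\<close> by (simp add: finite_image_iff inj_on_subset infinite_Ici)
    ultimately show "infinite {g \<in> carrier G. \<forall>t\<in>L. t \<otimes> g \<in> Q \<longleftrightarrow> t \<in> Q}"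
      using finite_subset by blast
  qed
  moreover have "Q \<subseteq> ordered_products G p {N..}"
    using A_sub ordered_products_mono[of "{N..<_}" "{N..}" G p] by (fastforce simp: Q_def)
  moreover have "\<one> \<in> Q"
    using A1 by (auto simp: Q_def)
  ultimately show thesis
    using that by blast
qed

end

section \<open>Independent times\<close>

definition independent_times ::
  "'x topology \<Rightarrow> ('g \<Rightarrow> 'x \<Rightarrow> 'x) \<Rightarrow> 'i set \<Rightarrow> ('i \<Rightarrow> 'x set) \<Rightarrow> 'g set \<Rightarrow> bool" where
  "independent_times X \<phi> I W B \<longleftrightarrow>
     (\<forall>f. (\<forall>s\<in>B. f s \<in> I) \<longrightarrow> (\<exists>x\<in>topspace X. \<forall>s\<in>B. \<phi> s x \<in> W (f s)))"

lemma independent_times_mono: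
  assumes "independent_times X \<phi> I W B" "B' \<subseteq> B" "I \<noteq> {}"
  shows "independent_times X \<phi> I W B'"
  unfolding independent_times_def
proof (intro allI impI)
  fix f assume f: "\<forall>s\<in>B'. f s \<in> I"
  obtain i where i: "i \<in> I"
    using assms(3) by blast
  define f' where "f' s = (if s \<in> B' then f s else i)" for s
  have "\<forall>s\<in>B. f' s \<in> I"
    using f i by (simp add: f'_def)
  then obtain x where x: "x \<in> topspace X" "\<forall>s\<in>B. \<phi> s x \<in> W (f' s)"
    using assms(1) unfolding independent_times_def by blast
  have "\<forall>s\<in>B'. \<phi> s x \<in> W (f s)"
    using x(2) assms(2) by (metis f'_def subsetD)
  then show "\<exists>x\<in>topspace X. \<forall>s\<in>B'. \<phi> s x \<in> W (f s)"
    using x(1) by blast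
qed

text \<open>The points realising a labelling \<open>f\<close> of \<open>B\<close> form a nonempty
  open set \<open>A f\<close>. A common hitting time \<open>g\<close> from all \<open>A f\<close> to
  all \<open>W i\<close> can be added to \<open>B\<close>, and since there are infinitely many such
  times, one lies outside \<open>B\<close>.\<close>

lemma independent_times_extend:
  assumes G: "group G" and X: "G_system G X \<phi>" and mm: "mildly_mixing G X \<phi>"
    and M: "contains_hitting_times G M" and I: "finite I"
    and W: "\<And>i. i \<in> I \<Longrightarrow> openin X (W i) \<and> W i \<noteq> {}"
    and B: "finite B" "B \<subseteq> carrier G" "independent_times X \<phi> I W B"
  obtains g where "g \<in> M" "g \<notin> B"
    "\<forall>f. (\<forall>s\<in>B. f s \<in> I) \<longrightarrow>
      (\<forall>i\<in>I. \<exists>x\<in>topspace X. (\<forall>s\<in>B. \<phi> s x \<in> W (f s)) \<and> \<phi> g x \<in> W i)"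
proof -
  define A where "A f = (\<Inter>s\<in>B. {x \<in> topspace X. \<phi> s x \<in> W (f s)}) \<inter> topspace X" for f
  have A: "openin X (A f) \<and> A f \<noteq> {}" if f: "\<forall>s\<in>B. f s \<in> I" for f
  proof
    show "openin X (A f)"
      unfolding A_def using B f W G_system_openin_preimage[OF X]
      by (intro openin_INT) auto
    obtain x where "x \<in> topspace X" "\<forall>s\<in>B. \<phi> s x \<in> W (f s)"
      using B(3) f unfolding independent_times_def by blast
    then have "x \<in> A f"
      by (simp add: A_def)
    then show "A f \<noteq> {}"
      by blast
  qed
  \<comment> \<open>Only the values of a labelling on \<open>B\<close> matter, so extensional
    functions suffice and there are finitely many pairs of sets to treat.\<close>
  define J where "J = (B \<rightarrow>\<^sub>E I) \<times> I"
  have AJ: "openin X (A (fst j)) \<and> A (fst j) \<noteq> {}" if "j \<in> J" for j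
    using that by (intro A) (auto simp: J_def)
  have "finite J"
    using B(1) I by (simp add: J_def finite_PiE)
  then have "contains_hitting_times G (M \<inter> (\<Inter>j\<in>J. hitting_times G \<phi> (A (fst j)) (W (snd j))))"
    by (rule mildly_mixing_INT_hitting_times[OF G X mm M]) (use AJ W in \<open>auto simp: J_def\<close>)
  then have "infinite (M \<inter> (\<Inter>j\<in>J. hitting_times G \<phi> (A (fst j)) (W (snd j))))"
    by (rule contains_hitting_times_infinite[OF G])
  then have "\<not> M \<inter> (\<Inter>j\<in>J. hitting_times G \<phi> (A (fst j)) (W (snd j))) \<subseteq> B"
    using B(1) finite_subset by blast
  then obtain g where g: "g \<in> M" "g \<notin> B"
      "\<And>j. j \<in> J \<Longrightarrow> g \<in> hitting_times G \<phi> (A (fst j)) (W (snd j))"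
    by blast
  have "\<exists>x\<in>topspace X. (\<forall>s\<in>B. \<phi> s x \<in> W (f s)) \<and> \<phi> g x \<in> W i"
    if f: "\<forall>s\<in>B. f s \<in> I" and i: "i \<in> I" for f i
  proof -
    have "(restrict f B, i) \<in> J"
      using f i by (auto simp: J_def)
    then obtain x where "x \<in> A (restrict f B)" "\<phi> g x \<in> W i"
      using g(3) by (fastforce simp: hitting_times_def)
    then show ?thesis
      by (auto simp: A_def intro!: bexI[of _ x])
  qed
  then show thesis
    using that g by blast
qed

text \<open>Since \<open>N(A, B)\<close> is only known to meet sets of quotients \<open>u v\<^sup>-\<^sup>1\<close>, an independent set
  \<open>B\<close> is extended to \<open>B v \<union> {u}\<close> and not to a superset of \<open>B\<close>.  The process thus produces
  arbitrarily large finite independent sets, but no infinite one.\<close>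

lemma exists_independent_ordered_products:
  fixes G (structure)
  assumes G: "group G" and cnt: "countable (carrier G)"
    and X: "G_system G X \<phi>" and mm: "mildly_mixing G X \<phi>"
    and p: "range p \<subseteq> carrier G" and inf: "infinite (ordered_products G p UNIV)"
    and I: "finite I" and W: "\<And>i. i \<in> I \<Longrightarrow> openin X (W i) \<and> W i \<noteq> {}"
    and ne: "topspace X \<noteq> {}"
  shows "\<exists>B M. B \<subseteq> ordered_products G p {..<M} \<and> card B = n \<and> independent_times X \<phi> I W B"
proof (induction n)
  case 0
  show ?case
    using ne unfolding independent_times_def by (intro exI[of _ "{}"]) fastforce
next
  case (Suc n)
  interpret group G by (fact G)
  obtain B M where B: "B \<subseteq> ordered_products G p {..<M}" "card B = n"
      "independent_times X \<phi> I W B"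
    using Suc by blast
  have finB: "finite B"
    using B(1) finite_ordered_products finite_subset by blast
  have Bc: "B \<subseteq> carrier G"
    using B(1) ordered_products_subset_carrier[OF p] by blast
  \<comment> \<open>Indices from \<open>M\<close> on allow elements of \<open>Q\<close> to be
    multiplied to the right of elements of \<open>B\<close>.\<close>
  obtain Q where Q: "Q \<subseteq> ordered_products G p {M..}" "\<one> \<in> Q" "recurrent_set G Q"
    using recurrent_subset_of_ordered_products[OF cnt p inf] .
  obtain g where g: "g \<in> {g \<in> carrier G. \<exists>h\<in>carrier G. h \<in> Q \<and> g \<otimes> h \<in> Q}" "g \<notin> B"
      and ext: "\<forall>f. (\<forall>s\<in>B. f s \<in> I) \<longrightarrow>
        (\<forall>i\<in>I. \<exists>x\<in>topspace X. (\<forall>s\<in>B. \<phi> s x \<in> W (f s)) \<and> \<phi> g x \<in> W i)"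
    using independent_times_extend[OF G X mm recurrent_set_quotients[OF G cnt Q(3,2)] I W finB Bc B(3)] .
  obtain v where gc: "g \<in> carrier G" and v: "v \<in> carrier G" "v \<in> Q" "g \<otimes> v \<in> Q"
    using g(1) by blast
  obtain M1 where M1: "M \<le> M1" "v \<in> ordered_products G p {M..<M1}"
    using ordered_products_bounded v(2) Q(1) by (metis subsetD)
  obtain M2 where M2: "M \<le> M2" "g \<otimes> v \<in> ordered_products G p {M..<M2}"
    using ordered_products_bounded v(3) Q(1) by (metis subsetD)
  \<comment> \<open>This is the right translate by \<open>v\<close> of the independent set
    \<open>B\<close> extended by \<open>g\<close>. The translation brings \<open>g\<close>, a mere
    quotient of elements of \<open>Q\<close>, back among the ordered products.\<close>
  define B' where "B' = insert (g \<otimes> v) ((\<lambda>s. s \<otimes> v) ` B)"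
  have "{..<M} \<union> {M..<M1} \<subseteq> {..<max M1 M2}"
    using M1(1) by auto
  then have "ordered_products G p ({..<M} \<union> {M..<M1}) \<subseteq> ordered_products G p {..<max M1 M2}"
    by (rule ordered_products_mono)
  moreover have "s \<otimes> v \<in> ordered_products G p ({..<M} \<union> {M..<M1})" if "s \<in> B" for s
    using that B(1) by (intro ordered_products_mult[OF p _ M1(2)]) auto
  ultimately have "s \<otimes> v \<in> ordered_products G p {..<max M1 M2}" if "s \<in> B" for s
    using that by blast
  moreover have "g \<otimes> v \<in> ordered_products G p {..<max M1 M2}"
    using M2(2) ordered_products_mono[of "{M..<M2}" "{..<max M1 M2}" G p] by fastforce
  ultimately have B': "B' \<subseteq> ordered_products G p {..<max M1 M2}"
    by (auto simp: B'_def)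
  have "inj_on (\<lambda>s. s \<otimes> v) B"
    using Bc v(1) by (auto simp: subset_iff intro!: inj_onI)
  moreover have "g \<otimes> v \<notin> (\<lambda>s. s \<otimes> v) ` B"
    using g(2) Bc gc v(1) by (auto simp: subset_iff)
  ultimately have card: "card B' = Suc n"
    using finB B(2) by (simp add: B'_def card_image)
  have "independent_times X \<phi> I W B'"
    unfolding independent_times_def
  proof (intro allI impI)
    fix f assume f: "\<forall>s\<in>B'. f s \<in> I"
    obtain x where x: "x \<in> topspace X" "\<forall>s\<in>B. \<phi> s x \<in> W (f (s \<otimes> v))" "\<phi> g x \<in> W (f (g \<otimes> v))"
      using ext[rule_format, of "\<lambda>s. f (s \<otimes> v)" "f (g \<otimes> v)"] f by (auto simp: B'_def)
    \<comment> \<open>Moving \<open>x\<close> back by \<open>v\<close> makes \<open>s v\<close> act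
      on \<open>y\<close> as \<open>s\<close> acts on \<open>x\<close>, so independence survives the
      translation.\<close>
    define y where "y = \<phi> (inv v) x"
    have y: "y \<in> topspace X"
      using G_system_in_topspace[OF X] v(1) x(1) by (simp add: y_def)
    have "\<phi> (s \<otimes> v) y = \<phi> s x" if "s \<in> carrier G" for s
      using that v(1) x(1) y G_system_mult[OF X, of v "inv v" x] G_system_one[OF X x(1)]
        G_system_mult[OF X that v(1) y] by (simp add: y_def)
    then have "\<forall>s\<in>B'. \<phi> s y \<in> W (f s)"
      using x Bc gc by (auto simp: B'_def)
    then show "\<exists>x\<in>topspace X. \<forall>s\<in>B'. \<phi> s x \<in> W (f s)"
      using y by blast
  qed
  then show ?case
    using B' card by blast
qed

text \<open>Ordered products lie in \<open>H\<close> except possibly \<open>\<one>\<close>. An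
  independent set with enough spare elements is taken, and \<open>\<one>\<close> and
  \<open>E\<close> are removed from it; subsets of independent sets are independent.\<close>

lemma exists_independent_in_infinite_IP_set:
  fixes G (structure)
  assumes G: "group G" and cnt: "countable (carrier G)"
    and X: "G_system G X \<phi>" and mm: "mildly_mixing G X \<phi>" and H: "infinite_IP_set G H"
    and I: "finite I" "I \<noteq> {}" and W: "\<And>i. i \<in> I \<Longrightarrow> openin X (W i) \<and> W i \<noteq> {}"
    and E: "finite E"
  shows "\<exists>B. finite B \<and> B \<subseteq> H - E \<and> m \<le> card B \<and> independent_times X \<phi> I W B"
proof -
  obtain p where p: "range p \<subseteq> carrier G" "infinite (finite_products G p)" "finite_products G p \<subseteq> H"
    using H unfolding infinite_IP_set_def by blast
  have ne: "topspace X \<noteq> {}"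
    using I(2) W openin_subset by blast
  have inf: "infinite (ordered_products G p UNIV)"
    using p(2) by (simp add: ordered_products_UNIV)
  define k where "k = m + card (insert \<one> E)"
  obtain B M where B: "B \<subseteq> ordered_products G p {..<M}" "card B = k" "independent_times X \<phi> I W B"
    using exists_independent_ordered_products[where W = W and n = k, OF G cnt X mm p(1) inf I(1) W ne] by blast
  define B' where "B' = B - insert \<one> E"
  have "finite B"
    using B(1) finite_ordered_products finite_subset by blast
  then have "finite B'"
    by (simp add: B'_def)
  moreover have "B' \<subseteq> H - E"
    using B(1) ordered_products_mono[of "{..<M}" UNIV G p] ordered_products_UNIV[of G p] p(3)
    by (auto simp: B'_def)
  moreover have "m \<le> card B'"
    using diff_card_le_card_Diff[of "insert \<one> E" B] E B(2) by (simp add: B'_def k_def)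
  moreover have "independent_times X \<phi> I W B'"
    using independent_times_mono[OF B(3) _ I(2)] by (simp add: B'_def)
  ultimately show ?thesis
    by blast
qed

text \<open>Each block avoids the finite set \<open>F r\<close> that holds the earlier blocks and is
  much larger than \<open>F r\<close>. Within \<open>F (r k)\<close>, the union therefore consists
  of \<open>B k\<close> up to a proportion that tends to \<open>0\<close>.\<close>

lemma union_of_growing_blocks:
  fixes F :: "nat \<Rightarrow> 'a set"
  assumes F: "incseq F" "\<And>n. finite (F n)" and H: "H \<subseteq> (\<Union>n. F n)"
    and blocks: "\<And>E m. finite E \<Longrightarrow> \<exists>B. finite B \<and> B \<subseteq> H - E \<and> m \<le> card B \<and> P B"
  obtains S r B where "S \<subseteq> H" "infinite S" "strict_mono r"
    "\<And>k. B k \<subseteq> S \<inter> F (r k)" "\<And>k. B k \<noteq> {}" "\<And>k. P (B k)"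
    "\<And>k. k * card (S \<inter> F (r k)) \<le> (k + 1) * card (B k)"
proof -
  have absorb: "\<exists>r'>r. B \<subseteq> F r'" if B: "finite B" "B \<subseteq> H" for B and r :: nat
  proof -
    have "\<forall>b\<in>B. eventually (\<lambda>n. b \<in> F n) sequentially"
      using B(2) H F(1) unfolding eventually_sequentially incseq_def by blast
    then have "eventually (\<lambda>n. \<forall>b\<in>B. b \<in> F n) sequentially"
      using B(1) by (simp add: eventually_ball_finite)
    then have "eventually (\<lambda>n. (\<forall>b\<in>B. b \<in> F n) \<and> r < n) sequentially"
      by (intro eventually_conj eventually_gt_at_top)
    then show ?thesis
      unfolding eventually_sequentially by blast
  qed
  define A where "A = (\<lambda>n (B, r :: nat). finite B \<and> B \<subseteq> H \<and> B \<subseteq> F r \<and> P B \<and> n + 1 \<le> card B)"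
  define R where "R = (\<lambda>n (B :: 'a set, r :: nat) (B', r').
      r < r' \<and> B' \<inter> F r = {} \<and> (n + 1) * card (F r) \<le> card B')"
  have "\<exists>f. \<forall>n. A n (f n) \<and> R n (f n) (f (Suc n))"
  proof (rule dependent_nat_choice)
    obtain B where "finite B" "B \<subseteq> H" "1 \<le> card B" "P B"
      using blocks[of "{}" 1] by auto
    moreover from this obtain r where "B \<subseteq> F r"
      using absorb by blast
    ultimately show "\<exists>x. A 0 x"
      by (auto simp: A_def)
    fix x n assume "A n x"
    obtain B r where x: "x = (B, r)" by force
    \<comment> \<open>The first summand makes \<open>F r\<close> negligible against the new block;
      the second provides the size bound \<open>n + 2\<close> required at stage
      \<open>Suc n\<close>.\<close>
    obtain B' where B': "finite B'" "B' \<subseteq> H - F r" "(n + 1) * card (F r) + (n + 2) \<le> card B'" "P B'"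
      using blocks[of "F r" "(n + 1) * card (F r) + (n + 2)"] F(2) by blast
    obtain r' where "r < r'" "B' \<subseteq> F r'"
      using absorb[of B' r] B' by blast
    then have "A (Suc n) (B', r') \<and> R n x (B', r')"
      using B' by (auto simp: A_def R_def x)
    then show "\<exists>y. A (Suc n) y \<and> R n x y"
      by blast
  qed
  then obtain f where f: "\<And>n. A n (f n)" "\<And>n. R n (f n) (f (Suc n))"
    by blast
  define B where "B n = fst (f n)" for n
  define r where "r n = snd (f n)" for n
  have B: "finite (B n)" "B n \<subseteq> H" "B n \<subseteq> F (r n)" "P (B n)" "n + 1 \<le> card (B n)" for n
    using f(1)[of n] by (auto simp: A_def B_def r_def split: prod.splits)
  have R: "r n < r (Suc n)" "B (Suc n) \<inter> F (r n) = {}" "(n + 1) * card (F (r n)) \<le> card (B (Suc n))"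
    for n
    using f(2)[of n] by (auto simp: R_def B_def r_def split: prod.splits)
  have r: "strict_mono r"
    using R(1) by (simp add: strict_mono_Suc_iff)
  have Fr: "F (r m) \<subseteq> F (r n)" if "m \<le> n" for m n
    using F(1) r that by (simp add: incseq_def strict_mono_less_eq)
  define S where "S = (\<Union>n. B n)"
  \<comment> \<open>Blocks up to \<open>k\<close> lie in \<open>F (r k)\<close>, and blocks after
    \<open>Suc k\<close> avoid \<open>F (r (Suc k))\<close>.\<close>
  have S_split: "S \<inter> F (r (Suc k)) \<subseteq> B (Suc k) \<union> F (r k)" for k
  proof
    fix s assume s: "s \<in> S \<inter> F (r (Suc k))"
    then obtain j where j: "s \<in> B j"
      by (auto simp: S_def)
    consider "j \<le> k" | "j = Suc k" | i where "j = Suc i" "Suc k \<le> i"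
      by (metis Suc_le_eq le_SucE not_less_eq_eq less_imp_Suc_add le_add1 add_Suc)
    then show "s \<in> B (Suc k) \<union> F (r k)"
    proof cases
      case 1
      then show ?thesis using j B(3) Fr by blast
    next
      case 2
      then show ?thesis using j by blast
    next
      case 3
      then show ?thesis using j s R(2)[of i] Fr[of "Suc k" i] by blast
    qed
  qed
  have ratio: "k * card (S \<inter> F (r k)) \<le> (k + 1) * card (B k)" for k
  proof (cases k)
    case (Suc j)
    have "card (S \<inter> F (r k)) \<le> card (B k \<union> F (r j))"
      using S_split[of j] B(1) F(2) unfolding Suc by (intro card_mono) auto
    also have "\<dots> \<le> card (B k) + card (F (r j))"
      by (rule card_Un_le)
    finally have "k * card (S \<inter> F (r k)) \<le> k * card (B k) + k * card (F (r j))"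
      by (metis add_mult_distrib2 mult_le_mono2)
    also have "\<dots> \<le> (k + 1) * card (B k)"
      using R(3)[of j] Suc by simp
    finally show ?thesis .
  qed simp
  \<comment> \<open>If \<open>S\<close> were finite, the block numbered \<open>card S\<close> would
    have more elements than \<open>S\<close>.\<close>
  have "infinite S"
  proof
    assume S: "finite S"
    then have "card (B (card S)) \<le> card S"
      by (intro card_mono) (auto simp: S_def)
    then show False
      using B(5)[of "card S"] by simp
  qed
  moreover have "S \<subseteq> H"
    using B(2) by (auto simp: S_def)
  moreover have "B k \<subseteq> S \<inter> F (r k)" for k
    using B(3) by (auto simp: S_def)
  moreover have "B k \<noteq> {}" for k
    using B(5)[of k] by auto
  ultimately show thesis
    using that r ratio B(4) by blast
qed

section \<open>Covering numbers\<close>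

lemma cover_number_attained:
  assumes "\<V> \<subseteq> \<U>" "finite \<V>" "\<Union>\<V> = topspace X"
  obtains \<V>' where "\<V>' \<subseteq> \<U>" "finite \<V>'" "\<Union>\<V>' = topspace X" "card \<V>' = cover_number X \<U>"
proof -
  have "{card \<V> | \<V>. \<V> \<subseteq> \<U> \<and> finite \<V> \<and> \<Union>\<V> = topspace X} \<noteq> {}"
    using assms by blast
  then have "cover_number X \<U> \<in> {card \<V> | \<V>. \<V> \<subseteq> \<U> \<and> finite \<V> \<and> \<Union>\<V> = topspace X}"
    unfolding cover_number_def by (rule Inf_nat_def1)
  then show thesis
    using that by auto
qed

lemma cover_number_le:
  assumes "\<V> \<subseteq> \<U>" "finite \<V>" "\<Union>\<V> = topspace X"
  shows "cover_number X \<U> \<le> card \<V>"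
  unfolding cover_number_def by (rule cInf_lower) (use assms in auto)

section \<open>Refinements of a fixed finite cover: counting and entropy bounds\<close>

context
  fixes G :: "('g, 'm) monoid_scheme" (structure) and X :: "'x topology" and \<phi> \<U>
  assumes G: "group G" and X: "G_system G X \<phi>" and \<U>: "finite \<U>" "open_cover X \<U>"
begin

interpretation group G
  by (fact G)

text \<open>Translates are defined as images under the inverse element; this lets them be used as
  preimages.\<close>

lemma mem_inverse_translate:
  assumes "g \<in> carrier G" "U \<subseteq> topspace X" "x \<in> topspace X"
  shows "x \<in> \<phi> (inv g) ` U \<longleftrightarrow> \<phi> g x \<in> U"
proof
  assume "x \<in> \<phi> (inv g) ` U"
  then obtain u where u: "u \<in> U" "x = \<phi> (inv g) u" by blast
  then have "\<phi> g x = u"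
    using assms G_system_mult[OF X, of g "inv g" u] G_system_one[OF X, of u] by auto
  then show "\<phi> g x \<in> U"
    using u by simp
next
  assume *: "\<phi> g x \<in> U"
  have "x = \<phi> (inv g) (\<phi> g x)"
    using assms G_system_mult[OF X, of "inv g" g x] G_system_one[OF X, of x] by auto
  then show "x \<in> \<phi> (inv g) ` U"
    using * by blast
qed

lemma common_refinement_cover:
  assumes T: "finite T" "T \<subseteq> carrier G"
  shows "finite (common_refinement X T (\<lambda>g. inverse_translate G \<phi> g \<U>))"
    "card (common_refinement X T (\<lambda>g. inverse_translate G \<phi> g \<U>)) \<le> card \<U> ^ card T"
    "\<Union>(common_refinement X T (\<lambda>g. inverse_translate G \<phi> g \<U>)) = topspace X"
proof -
  let ?R = "common_refinement X T (\<lambda>g. inverse_translate G \<phi> g \<U>)"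
  define e where "e f = topspace X \<inter> (\<Inter>t\<in>T. \<phi> (inv t) ` f t)" for f
  have fin: "finite (T \<rightarrow>\<^sub>E \<U>)"
    using T \<U> by (simp add: finite_PiE)
  have sub: "?R \<subseteq> e ` (T \<rightarrow>\<^sub>E \<U>)"
  proof
    fix A assume "A \<in> ?R"
    then obtain V where A: "A = topspace X \<inter> (\<Inter>t\<in>T. V t)"
        and "\<forall>t\<in>T. V t \<in> inverse_translate G \<phi> t \<U>"
      unfolding common_refinement_def by blast
    then have "\<forall>t\<in>T. \<exists>U. U \<in> \<U> \<and> V t = \<phi> (inv t) ` U"
      unfolding inverse_translate_def by blast
    then obtain f where f: "\<And>t. t \<in> T \<Longrightarrow> f t \<in> \<U> \<and> V t = \<phi> (inv t) ` f t"
      by metis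
    then have "A = e (restrict f T)"
      by (simp add: A e_def)
    moreover have "restrict f T \<in> T \<rightarrow>\<^sub>E \<U>"
      using f by simp
    ultimately show "A \<in> e ` (T \<rightarrow>\<^sub>E \<U>)"
      by blast
  qed
  then show "finite ?R"
    using fin finite_surj by blast
  have "card ?R \<le> card (T \<rightarrow>\<^sub>E \<U>)"
    by (rule surj_card_le[OF fin sub])
  then show "card ?R \<le> card \<U> ^ card T"
    using T(1) by (simp add: card_PiE)
  show "\<Union>?R = topspace X"
  proof
    show "\<Union>?R \<subseteq> topspace X"
      unfolding common_refinement_def by blast
    show "topspace X \<subseteq> \<Union>?R"
    proof
      fix x assume x: "x \<in> topspace X"
      have "\<phi> t x \<in> \<Union>\<U>" if "t \<in> T" for t
        using \<U>(2) G_system_in_topspace[OF X _ x, of t] T(2) that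
        by (auto simp: open_cover_def)
      then have "\<exists>U\<in>\<U>. \<phi> t x \<in> U" if "t \<in> T" for t
        using that by blast
      then obtain f where f: "\<And>t. t \<in> T \<Longrightarrow> f t \<in> \<U> \<and> \<phi> t x \<in> f t"
        by metis
      have "x \<in> \<phi> (inv t) ` f t" if "t \<in> T" for t
      proof -
        have "f t \<subseteq> topspace X"
          using f[OF that] \<U>(2) by (auto simp: open_cover_def)
        then show ?thesis
          using mem_inverse_translate[OF _ _ x] f[OF that] T(2) that by blast
      qed
      moreover have "topspace X \<inter> (\<Inter>t\<in>T. \<phi> (inv t) ` f t) \<in> ?R"
        unfolding common_refinement_def inverse_translate_def using f by blast
      ultimately show "x \<in> \<Union>?R"
        using x by blast
    qed
  qed
qed

text \<open>Among the \<open>card \<U> ^ card B\<close> points given by independence, an element of the refinement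
  with coordinates \<open>U\<^sub>s\<close> contains only those whose labels \<open>f s\<close> satisfy \<open>W (f s) \<inter> U\<^sub>s \<noteq> {}\<close>.\<close>

lemma card_subcover_of_refinement:
  assumes T: "finite T" "T \<subseteq> carrier G" and B: "B \<subseteq> T" "independent_times X \<phi> \<U> W B"
    and c: "\<And>U. U \<in> \<U> \<Longrightarrow> card {U' \<in> \<U>. W U' \<inter> U \<noteq> {}} \<le> c"
    and \<V>: "\<V> \<subseteq> common_refinement X T (\<lambda>g. inverse_translate G \<phi> g \<U>)"
      "finite \<V>" "\<Union>\<V> = topspace X"
  shows "card \<U> ^ card B \<le> card \<V> * c ^ card B"
proof -
  have finB: "finite B"
    using B(1) T(1) finite_subset by blast
  have "\<exists>x. x \<in> topspace X \<and> (\<forall>s\<in>B. \<phi> s x \<in> W (f s))" if "f \<in> B \<rightarrow>\<^sub>E \<U>" for f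
    using B(2) that unfolding independent_times_def by (metis PiE_mem)
  then obtain x where x: "\<And>f. f \<in> B \<rightarrow>\<^sub>E \<U> \<Longrightarrow> x f \<in> topspace X \<and> (\<forall>s\<in>B. \<phi> s (x f) \<in> W (f s))"
    by metis
  \<comment> \<open>The labellings whose chosen point falls into \<open>V\<close>. As
    \<open>\<V>\<close> covers the space, these sets exhaust all labellings, so it suffices to bound
    each of them.\<close>
  define N where "N V = {f \<in> B \<rightarrow>\<^sub>E \<U>. x f \<in> V}" for V
  have N: "card (N V) \<le> c ^ card B" if "V \<in> \<V>" for V
  proof -
    have "V \<in> common_refinement X T (\<lambda>g. inverse_translate G \<phi> g \<U>)"
      using \<V>(1) that by blast
    then obtain Y where Y: "V = topspace X \<inter> (\<Inter>t\<in>T. Y t)"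
        and "\<forall>t\<in>T. Y t \<in> inverse_translate G \<phi> t \<U>"
      unfolding common_refinement_def by blast
    then have "\<forall>t\<in>T. \<exists>U. U \<in> \<U> \<and> Y t = \<phi> (inv t) ` U"
      unfolding inverse_translate_def by blast
    then obtain u where u: "\<And>t. t \<in> T \<Longrightarrow> u t \<in> \<U> \<and> Y t = \<phi> (inv t) ` u t"
      by metis
    define D where "D s = {U' \<in> \<U>. W U' \<inter> u s \<noteq> {}}" for s
    have "N V \<subseteq> Pi\<^sub>E B D"
    proof
      fix f assume "f \<in> N V"
      then have f: "f \<in> B \<rightarrow>\<^sub>E \<U>" "x f \<in> V"
        by (auto simp: N_def)
      have "f s \<in> D s" if s: "s \<in> B" for s
      proof -
        have "u s \<subseteq> topspace X"
          using u[OF subsetD[OF B(1) s]] \<U>(2) by (auto simp: open_cover_def)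
        moreover have "x f \<in> \<phi> (inv s) ` u s"
          using f(2) Y u s B(1) by blast
        ultimately have "\<phi> s (x f) \<in> u s"
          using mem_inverse_translate x[OF f(1)] s B(1) T(2) by blast
        then show ?thesis
          using x[OF f(1)] s f(1) by (auto simp: D_def)
      qed
      then show "f \<in> Pi\<^sub>E B D"
        using f(1) by (auto simp: PiE_iff)
    qed
    moreover have finD: "finite (D s)" for s
      using \<U>(1) by (simp add: D_def)
    ultimately have "card (N V) \<le> card (Pi\<^sub>E B D)"
      using finB by (intro card_mono finite_PiE) auto
    also have "\<dots> = (\<Prod>s\<in>B. card (D s))"
      using finB by (simp add: card_PiE)
    also have "\<dots> \<le> (\<Prod>s\<in>B. c)"
      using c u B(1) by (intro prod_mono) (auto simp: D_def)
    finally show ?thesis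
      by simp
  qed
  have "B \<rightarrow>\<^sub>E \<U> \<subseteq> (\<Union>V\<in>\<V>. N V)"
    using x \<V>(3) by (fastforce simp: N_def)
  moreover have "finite (\<Union>V\<in>\<V>. N V)"
    using finB \<U>(1) \<V>(2) by (auto simp: N_def finite_PiE)
  ultimately have "card (B \<rightarrow>\<^sub>E \<U>) \<le> card (\<Union>V\<in>\<V>. N V)"
    by (rule card_mono[rotated])
  also have "\<dots> \<le> (\<Sum>V\<in>\<V>. card (N V))"
    by (rule card_UN_le[OF \<V>(2)])
  also have "\<dots> \<le> card \<V> * c ^ card B"
    using sum_bounded_above[of \<V> "\<lambda>V. card (N V)" "c ^ card B"] N by simp
  finally show ?thesis
    using finB by (simp add: card_PiE)
qed

lemma cover_number_refinement_ge:
  assumes T: "finite T" "T \<subseteq> carrier G" and B: "B \<subseteq> T" "independent_times X \<phi> \<U> W B"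
    and c: "\<And>U. U \<in> \<U> \<Longrightarrow> card {U' \<in> \<U>. W U' \<inter> U \<noteq> {}} \<le> c"
  shows "card \<U> ^ card B \<le>
    cover_number X (common_refinement X T (\<lambda>g. inverse_translate G \<phi> g \<U>)) * c ^ card B"
proof -
  let ?R = "common_refinement X T (\<lambda>g. inverse_translate G \<phi> g \<U>)"
  obtain \<V> where "\<V> \<subseteq> ?R" "finite \<V>" "\<Union>\<V> = topspace X" "card \<V> = cover_number X ?R"
    using cover_number_attained[OF subset_refl common_refinement_cover(1,3)[OF T]] .
  then show ?thesis
    using card_subcover_of_refinement[OF T B c] by metis
qed

lemma cover_number_refinement_le:
  assumes T: "finite T" "T \<subseteq> carrier G"
  shows "cover_number X (common_refinement X T (\<lambda>g. inverse_translate G \<phi> g \<U>)) \<le> card \<U> ^ card T"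
  using cover_number_le[OF subset_refl common_refinement_cover(1,3)[OF T]]
    common_refinement_cover(2)[OF T] by linarith

lemma h_top_le:
  assumes F: "\<And>n. finite (F n)" "\<And>n. F n \<subseteq> carrier G" and ne: "topspace X \<noteq> {}"
  shows "h_top G X \<phi> S F \<U> \<le> ereal (ln (real (card \<U>)))"
  unfolding h_top_def
proof (intro Limsup_bounded always_eventually allI)
  fix n
  define T where "T = S \<inter> F n"
  have T: "finite T" "T \<subseteq> carrier G"
    using F[of n] by (auto simp: T_def)
  define k where "k = cover_number X (common_refinement X T (\<lambda>g. inverse_translate G \<phi> g \<U>))"
  have "\<U> \<noteq> {}"
    using ne \<U>(2) unfolding open_cover_def by (metis Union_empty)
  then have c: "card \<U> > 0"
    using \<U>(1) by (simp add: card_gt_0_iff)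
  \<comment> \<open>The case \<open>k = 0\<close> is harmless because \<open>ln 0\<close> is
    \<open>0\<close> and the right-hand side is nonnegative.\<close>
  have "ln (real k) \<le> real (card T) * ln (real (card \<U>))"
  proof (cases "k = 0")
    case False
    have "real k \<le> real (card \<U>) ^ card T"
      using cover_number_refinement_le[OF T] unfolding k_def by (metis of_nat_le_iff of_nat_power)
    then have "ln (real k) \<le> ln (real (card \<U>) ^ card T)"
      using False c by (subst ln_le_cancel_iff) auto
    then show ?thesis
      using c by (simp add: ln_realpow)
  qed (use c in simp)
  then have "1 / real (card T) * ln (real k) \<le> ln (real (card \<U>))"
    using c by (cases "card T = 0") (auto simp: field_simps)
  then show "ereal (1 / real (card (S \<inter> F n)) * ln (real (cover_number X
      (common_refinement X (S \<inter> F n) (\<lambda>g. inverse_translate G \<phi> g \<U>))))) \<le> ereal (ln (real (card \<U>)))"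
    by (simp add: k_def T_def)
qed

text \<open>Logarithms of the counting bound give at least
  \<open>card (B k) * ln (card \<U> / c)\<close> at time \<open>r k\<close>. The block has at least
  the proportion \<open>k / (k + 1)\<close> of \<open>S \<inter> F (r k)\<close>, so the normalised
  values along \<open>r\<close> have upper limit at least \<open>ln (card \<U> / c)\<close>.\<close>

lemma h_top_ge:
  assumes F: "\<And>n. finite (F n)" "\<And>n. F n \<subseteq> carrier G"
    and c: "\<And>U. U \<in> \<U> \<Longrightarrow> card {U' \<in> \<U>. W U' \<inter> U \<noteq> {}} \<le> c" "0 < c" "c \<le> card \<U>"
    and r: "strict_mono r" and B: "\<And>k. B k \<subseteq> S \<inter> F (r k)" "\<And>k. B k \<noteq> {}"
      "\<And>k. independent_times X \<phi> \<U> W (B k)"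
      "\<And>k. k * card (S \<inter> F (r k)) \<le> (k + 1) * card (B k)"
  shows "ereal (ln (real (card \<U>) / real c)) \<le> h_top G X \<phi> S F \<U>"
proof -
  define N where "N n = cover_number X
      (common_refinement X (S \<inter> F n) (\<lambda>g. inverse_translate G \<phi> g \<U>))" for n
  define a where "a n = ereal (1 / real (card (S \<inter> F n)) * ln (real (N n)))" for n
  define L where "L = ln (real (card \<U>) / real c)"
  \<comment> \<open>The sign allows the lower bound on the proportion of the block to be multiplied
    by \<open>L\<close>.\<close>
  have L: "L \<ge> 0"
    using c(2,3) by (simp add: L_def)
  have a: "ereal (real k / real (Suc k) * L) \<le> a (r k)" for k
  proof -
    define T where "T = S \<inter> F (r k)"
    have T: "finite T" "T \<subseteq> carrier G"
      using F[of "r k"] by (auto simp: T_def)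
    have "T \<noteq> {}"
      using B(1,2)[of k] by (auto simp: T_def)
    then have cT: "card T > 0"
      using T(1) by (simp add: card_gt_0_iff)
    have "card \<U> ^ card (B k) \<le> N (r k) * c ^ card (B k)"
      using cover_number_refinement_ge[OF T _ B(3)[of k] c(1)] B(1)[of k] by (simp add: N_def T_def)
    then have le: "real (card \<U>) ^ card (B k) \<le> real (N (r k)) * real c ^ card (B k)"
      by (metis of_nat_le_iff of_nat_mult of_nat_power)
    then have "(real (card \<U>) / real c) ^ card (B k) \<le> real (N (r k))"
      using c(2) by (simp add: power_divide divide_le_eq)
    moreover have "0 < (real (card \<U>) / real c) ^ card (B k)"
      using c(2,3) by simp
    ultimately have "ln ((real (card \<U>) / real c) ^ card (B k)) \<le> ln (real (N (r k)))"
      by simp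
    then have "real (card (B k)) * L \<le> ln (real (N (r k)))"
      using c(2,3) by (simp add: L_def ln_realpow)
    moreover have "real k * real (card T) \<le> real (Suc k) * real (card (B k))"
      using B(4)[of k] unfolding T_def by (metis Suc_eq_plus1 of_nat_le_iff of_nat_mult)
    then have "real k / real (Suc k) * real (card T) \<le> real (card (B k))"
      by (simp add: field_simps)
    then have "real k / real (Suc k) * real (card T) * L \<le> real (card (B k)) * L"
      using L by (rule mult_right_mono)
    ultimately have "real k / real (Suc k) * L * real (card T) \<le> ln (real (N (r k)))"
      by (simp add: mult.assoc mult.commute mult.left_commute)
    then have "real k / real (Suc k) * L \<le> ln (real (N (r k))) / real (card T)"
      using cT by (subst pos_le_divide_eq) auto
    then show ?thesis
      by (simp add: a_def T_def)
  qed
  have "(\<lambda>k. real k / real (Suc k) * L) \<longlonglongrightarrow> 1 * L"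
    by (intro tendsto_intros LIMSEQ_n_over_Suc_n)
  then have "(\<lambda>k. ereal (real k / real (Suc k) * L)) \<longlonglongrightarrow> ereal L"
    by simp
  then have "ereal L = limsup (\<lambda>k. ereal (real k / real (Suc k) * L))"
    by (intro lim_imp_Limsup[symmetric]) simp_all
  also have "\<dots> \<le> limsup (a \<circ> r)"
    using a by (intro Limsup_mono always_eventually) simp
  also have "\<dots> \<le> limsup a"
    by (rule limsup_subseq_mono[OF r])
  finally show ?thesis
    unfolding h_top_def a_def N_def L_def .
qed

end

section \<open>Sequence entropy along infinite IP-sets\<close>

text \<open>Mild mixing yields a point of \<open>X\<close> once some transitive recurrent system is
  available. The whole group is a recurrent set since it is infinite, and
  \<open>recurrent_set_quotients\<close> supplies a system from it.\<close>

lemma mildly_mixing_nonempty: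
  assumes "group G" "infinite (carrier G)" "countable (carrier G)" "mildly_mixing G X \<phi>"
  shows "topspace X \<noteq> {}"
proof -
  interpret group G by fact
  have "{g \<in> carrier G. \<forall>t\<in>K. t \<otimes>\<^bsub>G\<^esub> g \<in> carrier G \<longleftrightarrow> t \<in> carrier G} = carrier G"
    if "K \<subseteq> carrier G" for K
    using that by auto
  then have "recurrent_set G (carrier G)"
    using assms(2) by (simp add: recurrent_set_def)
  then have "contains_hitting_times G
      {g \<in> carrier G. \<exists>h\<in>carrier G. h \<in> carrier G \<and> g \<otimes>\<^bsub>G\<^esub> h \<in> carrier G}"
    using recurrent_set_quotients assms by blast
  then obtain Z :: "real topology" and \<zeta> where "G_system G Z \<zeta>" "transitive_recurrent G Z \<zeta>"
    unfolding contains_hitting_times_def by blast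
  then have "transitive_recurrent G (prod_topology X Z) (diagonal_action X \<phi> Z \<zeta>)"
    using assms(4) unfolding mildly_mixing_def by blast
  then show ?thesis
    by (auto simp: transitive_recurrent_def transitive_point_def)
qed

text \<open>Common source of both claims: the number \<open>c\<close> bounds how many of the open
  sets \<open>W U'\<close> a single member of the cover can meet.\<close>

lemma exists_large_sequence_entropy:
  fixes G :: "('g, 'm) monoid_scheme"
  assumes G: "group G" and cnt: "countable (carrier G)" and F: "folner_sequence G F"
    and X: "G_system G X \<phi>" and mm: "mildly_mixing G X \<phi>" and H: "infinite_IP_set G H"
    and \<U>: "finite \<U>" "open_cover X \<U>" "\<U> \<noteq> {}"
    and W: "\<And>U. U \<in> \<U> \<Longrightarrow> openin X (W U) \<and> W U \<noteq> {}"
    and c: "\<And>U. U \<in> \<U> \<Longrightarrow> card {U' \<in> \<U>. W U' \<inter> U \<noteq> {}} \<le> c" "0 < c" "c \<le> card \<U>"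
  shows "\<exists>S. S \<subseteq> H \<and> infinite S \<and> ereal (ln (real (card \<U>) / real c)) \<le> h_top G X \<phi> S F \<U>"
proof -
  have F': "incseq F" "\<And>n. finite (F n)" "\<And>n. F n \<subseteq> carrier G" "(\<Union>n. F n) = carrier G"
    using F by (auto simp: folner_sequence_def asymptotically_invariant_def)
  have HF: "H \<subseteq> (\<Union>n. F n)"
    using H F'(4) by (simp add: infinite_IP_set_def)
  obtain S r B where S: "S \<subseteq> H" "infinite S" and r: "strict_mono r"
    and B: "\<And>k. B k \<subseteq> S \<inter> F (r k)" "\<And>k. B k \<noteq> {}" "\<And>k. independent_times X \<phi> \<U> W (B k)"
      "\<And>k. k * card (S \<inter> F (r k)) \<le> (k + 1) * card (B k)"
    using union_of_growing_blocks[where P = "independent_times X \<phi> \<U> W", OF F'(1,2) HF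
        exists_independent_in_infinite_IP_set[OF G cnt X mm H \<U>(1,3) W]] by blast
  show ?thesis
    using S h_top_ge[OF G X \<U>(1,2) F'(2,3) c r B] by blast
qed

text \<open>A member missing from \<open>\<V>\<close> would leave its private points
  uncovered.\<close>

lemma admissible_cover_minimal:
  assumes "admissible_cover X \<U>" "\<V> \<subseteq> \<U>" "\<Union>\<V> = topspace X"
  shows "\<V> = \<U>"
proof (rule ccontr)
  assume "\<V> \<noteq> \<U>"
  then obtain U where U: "U \<in> \<U>" "U \<notin> \<V>"
    using assms(2) by blast
  then have "X interior_of (U - \<Union>(\<U> - {U})) \<noteq> {}"
    using assms(1) by (auto simp: admissible_cover_def)
  then obtain x where x: "x \<in> U" "x \<notin> \<Union>(\<U> - {U})"
    using interior_of_subset by fastforce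
  have "x \<in> \<Union>\<V>"
    using x(1) U(1) assms(1,3) by (auto simp: admissible_cover_def open_cover_def)
  then show False
    using x(2) U(2) assms(2) by blast
qed

lemma admissible_cover_number:
  assumes "compact_space X" "admissible_cover X \<U>"
  shows "finite \<U>" "cover_number X \<U> = card \<U>"
proof -
  have \<U>: "\<And>U. U \<in> \<U> \<Longrightarrow> openin X U" "\<Union>\<U> = topspace X"
    using assms(2) by (auto simp: admissible_cover_def open_cover_def)
  obtain \<V> where \<V>: "finite \<V>" "\<V> \<subseteq> \<U>" "topspace X \<subseteq> \<Union>\<V>"
    using assms(1) \<U> unfolding compact_space_def compactin_def by (metis subset_refl)
  then have "\<Union>\<V> = topspace X"
    using \<U>(2) by blast
  then show fin: "finite \<U>"
    using admissible_cover_minimal[OF assms(2) \<V>(2)] \<V>(1) by simp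
  show "cover_number X \<U> = card \<U>"
    using cover_number_attained[OF subset_refl fin \<U>(2)] admissible_cover_minimal[OF assms(2)]
    by metis
qed

theorem theorem4p9:
  fixes G :: "('g, 'm) monoid_scheme"
    and F :: "nat \<Rightarrow> 'g set"
    and X :: "'x topology"
    and \<phi> :: "'g \<Rightarrow> 'x \<Rightarrow> 'x"
  assumes "group G" and "infinite (carrier G)" and "countable (carrier G)" and "amenable G"
    and "folner_sequence G F"
    and "G_system G X \<phi>"
    and "mildly_mixing G X \<phi>"
  shows "(\<forall>\<U> H. admissible_cover X \<U> \<longrightarrow> infinite_IP_set G H \<longrightarrow>
            (\<exists>S. S \<subseteq> H \<and> infinite S \<and> h_top G X \<phi> S F \<U> = ereal (ln (real (cover_number X \<U>)))))
       \<and> (\<forall>\<U> H. finite \<U> \<longrightarrow> nontrivial_cover X \<U> \<longrightarrow> infinite_IP_set G H \<longrightarrow>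
            (\<exists>S. S \<subseteq> H \<and> infinite S \<and> h_top G X \<phi> S F \<U> > 0))"
proof (intro conjI allI impI)
  note large = exists_large_sequence_entropy[OF assms(1,3,5,6,7)]
  have ne: "topspace X \<noteq> {}"
    using mildly_mixing_nonempty assms by blast
  have nonempty: "\<U> \<noteq> {}" if "open_cover X \<U>" for \<U>
    using that ne unfolding open_cover_def by (metis Union_empty)
  {
    fix \<U> H assume adm: "admissible_cover X \<U>" and H: "infinite_IP_set G H"
    have cov: "open_cover X \<U>"
      using adm by (simp add: admissible_cover_def)
    have fin: "finite \<U>" and num: "cover_number X \<U> = card \<U>"
      using admissible_cover_number[OF _ adm] assms(6) by (auto simp: G_system_def)
    \<comment> \<open>The private part of a member meets no other member of the cover, which gives
      \<open>c = 1\<close>.\<close>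
    define W where "W U = X interior_of (U - \<Union>(\<U> - {U}))" for U
    have W: "openin X (W U) \<and> W U \<noteq> {}" if "U \<in> \<U>" for U
      using adm that by (simp add: W_def admissible_cover_def)
    have sub: "W U \<subseteq> U - \<Union>(\<U> - {U})" for U
      unfolding W_def by (rule interior_of_subset)
    have "card {U' \<in> \<U>. W U' \<inter> U \<noteq> {}} \<le> 1" if "U \<in> \<U>" for U
    proof -
      have "{U' \<in> \<U>. W U' \<inter> U \<noteq> {}} \<subseteq> {U}"
        using sub that by blast
      then show ?thesis
        using card_mono[of "{U}"] by fastforce
    qed
    moreover have "1 \<le> card \<U>"
      using fin nonempty[OF cov] by (simp add: Suc_le_eq card_gt_0_iff)
    ultimately obtain S where S: "S \<subseteq> H" "infinite S"
        "ereal (ln (real (card \<U>) / real 1)) \<le> h_top G X \<phi> S F \<U>"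
      using large[where W = W and c = 1, OF H fin cov nonempty[OF cov] W] by auto
    moreover have "h_top G X \<phi> S F \<U> \<le> ereal (ln (real (card \<U>)))"
      using assms(5) by (intro h_top_le[OF assms(1,6) fin cov _ _ ne])
        (auto simp: folner_sequence_def asymptotically_invariant_def)
    ultimately show "\<exists>S. S \<subseteq> H \<and> infinite S \<and>
        h_top G X \<phi> S F \<U> = ereal (ln (real (cover_number X \<U>)))"
      by (auto simp: num intro!: exI[of _ S])
  next
    fix \<U> H assume fin: "finite \<U>" and nontriv: "nontrivial_cover X \<U>" and H: "infinite_IP_set G H"
    have cov: "open_cover X \<U>"
      using nontriv by (simp add: nontrivial_cover_def)
    \<comment> \<open>The exterior of \<open>U\<close> is nonempty as \<open>U\<close> is not dense,
      and it misses \<open>U\<close>. Hence each member meets at most \<open>card \<U> - 1\<close>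
      of these sets.\<close>
    define W where "W U = topspace X - X closure_of U" for U
    have W: "openin X (W U) \<and> W U \<noteq> {}" if "U \<in> \<U>" for U
      using nontriv that closure_of_subset_topspace[of X U] by (auto simp: W_def nontrivial_cover_def)
    have disj: "W U \<inter> U = {}" if "U \<in> \<U>" for U
      using cov that closure_of_subset[of U X] by (auto simp: W_def open_cover_def)
    have c: "card {U' \<in> \<U>. W U' \<inter> U \<noteq> {}} \<le> card \<U> - 1" if "U \<in> \<U>" for U
    proof -
      have "card {U' \<in> \<U>. W U' \<inter> U \<noteq> {}} \<le> card (\<U> - {U})"
        using fin disj by (intro card_mono) auto
      then show ?thesis
        using that by simp
    qed
    obtain U where U: "U \<in> \<U>"
      using nonempty[OF cov] by blast
    \<comment> \<open>A single member covering the space would be dense. With at least two members,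
      \<open>card \<U> - 1\<close> is positive and the entropy bound is the logarithm of a number
      above \<open>1\<close>.\<close>
    have "\<U> \<noteq> {U}"
      using nontriv by (auto simp: nontrivial_cover_def open_cover_def)
    then obtain V where "V \<in> \<U>" "V \<noteq> U"
      using U by blast
    then have "card {U, V} \<le> card \<U>"
      using U fin by (intro card_mono) auto
    then have card: "2 \<le> card \<U>"
      using \<open>V \<noteq> U\<close> by simp
    then obtain S where S: "S \<subseteq> H" "infinite S"
        "ereal (ln (real (card \<U>) / real (card \<U> - 1))) \<le> h_top G X \<phi> S F \<U>"
      using large[where W = W, OF H fin cov nonempty[OF cov] W c] by auto
    have "0 < ln (real (card \<U>) / real (card \<U> - 1))"
      using card by (intro ln_gt_zero) (simp add: field_simps)
    then have "0 < h_top G X \<phi> S F \<U>"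
      using S(3) by (metis ereal_less(2) less_le_trans)
    then show "\<exists>S. S \<subseteq> H \<and> infinite S \<and> h_top G X \<phi> S F \<U> > 0"
      using S by blast
  }
qed

end
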